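(* Let $\Phi\in\mathcal L^-[0,1]$ be nondecreasing, let $r_0>0$, and let $V$ be a real function on $(0,\infty)$ such that, for some $\delta>0$, the function $r\mapsto r^{-1-\delta}V(r)$ is strictly increasing. Then there are constants $c>0$ and $A\ge 1$ such that for every function $u$ that is subharmonic in $\mathbb C$, harmonic in $\mathbb C\setminus\mathbb R$, and satisfies $$\int_{-\pi}^{\pi}u^-(re^{i\theta})\,\Phi(|\sin\theta|)\,d\theta\le V(r)\qquad\forall r\ge r_0,$$ there is a number $r_1=r_1(u)$ such that $$u(re^{i\theta})\le c\,V(Ar)\qquad\forall r\ge r_1,\ \forall\theta\in[-\pi,\pi].$$ (The constants $c$ and $A$ are independent of $u$.)
   Context: For a real-valued function $h$, $h^+=\max\{h,0\}$ and $h^-=h^+-h=\max\{-h,0\}$. $\mathcal L^-[a,b]$ denotes the class of all nonnegative integrable functions $g$ on the segment $[a,b]$ such that $\int_a^b\log^-g(s)\,ds<\infty$ (with $\log^-0=+\infty$). *)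

theory Defs
  imports "HOL-Analysis.Analysis"
begin

definition log_minus :: "real \<Rightarrow> ennreal" where
  "log_minus x = (if x = 0 then \<infinity> else ennreal (max (- ln x) 0))"

(* Membership constrains only the values on {a..b}. *)
definition L_minus :: "real \<Rightarrow> real \<Rightarrow> (real \<Rightarrow> real) set" where
  "L_minus a b = {g. (\<forall>s\<in>{a..b}. 0 \<le> g s) \<and> set_integrable lebesgue {a..b} g \<and>
     (\<integral>\<^sup>+ s\<in>{a..b}. log_minus (g s) \<partial>lebesgue) < \<infinity>}"

(* Mean over a circle of a function with values in [-\<infinity>, \<infinity>): the positive part of an upper
   semicontinuous such function has finite integral, so \<infinity> - \<infinity> does not occur; the mean may
   be -\<infinity>. *)
definition circle_mean :: "(complex \<Rightarrow> ereal) \<Rightarrow> complex \<Rightarrow> real \<Rightarrow> ereal" where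
  "circle_mean u z \<rho> =
     (enn2ereal (\<integral>\<^sup>+ t\<in>{-pi..pi}. e2ennreal (max (u (z + rcis \<rho> t)) 0) \<partial>lborel)
      - enn2ereal (\<integral>\<^sup>+ t\<in>{-pi..pi}. e2ennreal (max (- u (z + rcis \<rho> t)) 0) \<partial>lborel))
     / ereal (2 * pi)"

(* The value -\<infinity> is allowed; u identically -\<infinity> is not excluded. *)
definition subharmonic_on :: "(complex \<Rightarrow> ereal) \<Rightarrow> complex set \<Rightarrow> bool" where
  "subharmonic_on u S \<longleftrightarrow> open S \<and>
     (\<forall>z\<in>S. u z < \<infinity>) \<and>
     (\<forall>a. openin (top_of_set S) {z \<in> S. u z < a}) \<and>
     (\<forall>z \<rho>. 0 < \<rho> \<longrightarrow> cball z \<rho> \<subseteq> S \<longrightarrow> u z \<le> circle_mean u z \<rho>)"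

(* h is C^2 with zero Laplacian: hx, hy are the first partial derivatives and hxx, hxy, hyx, hyy
   the second ones (hxy is the y-derivative of hx). *)
definition harmonic_on :: "(complex \<Rightarrow> real) \<Rightarrow> complex set \<Rightarrow> bool" where
  "harmonic_on h S \<longleftrightarrow> open S \<and>
     (\<exists>hx hy hxx hxy hyx hyy.
        continuous_on S hxx \<and> continuous_on S hxy \<and>
        continuous_on S hyx \<and> continuous_on S hyy \<and>
        (\<forall>z\<in>S.
           (h has_derivative (\<lambda>w. hx z * Re w + hy z * Im w)) (at z) \<and>
           (hx has_derivative (\<lambda>w. hxx z * Re w + hxy z * Im w)) (at z) \<and>
           (hy has_derivative (\<lambda>w. hyx z * Re w + hyy z * Im w)) (at z) \<and>
           hxx z + hyy z = 0))"

definition eharmonic_on :: "(complex \<Rightarrow> ereal) \<Rightarrow> complex set \<Rightarrow> bool" where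
  "eharmonic_on u S \<longleftrightarrow> (\<exists>h. harmonic_on h S \<and> (\<forall>z\<in>S. u z = ereal (h z)))"

end

theory Submission
  imports Defs "HOL-Complex_Analysis.Complex_Analysis"
begin

text \<open>
  In the logarithmic coordinate \<open>\<zeta> = \<xi> + \<i> y\<close>, \<open>z = exp \<zeta>\<close>, each of the two half-planes off the
  real axis becomes the strip \<open>0 < y < \<pi>\<close>, and \<open>u\<close> becomes the real part of a holomorphic function
  \<open>F\<close> on it. The hypothesis says that on every vertical segment the negative part of \<open>Re F\<close>,
  weighted by \<open>\<Phi> (sin y)\<close>, has mass at most \<open>v \<xi> = V (exp \<xi>)\<close>, where \<open>exp (- p \<xi>) v \<xi>\<close> increases
  for \<open>p = 1 + \<delta> > 1\<close>. The estimate has three stages.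

  \<^item> Negative part to positive part. Averaging over discs turns the weighted mass into a pointwise
  lower bound for \<open>Re F\<close> that degenerates only at the boundary of the strip
  (\<open>strip_lower_bound\<close>). A lower bound alone does not limit a harmonic function from above; the
  growth condition \<open>p > 1\<close> does. Take \<open>1 < q < p\<close> and let \<open>m \<xi>\<close> be the mean of \<open>Re F\<close> on the vertical
  line at \<open>\<xi>\<close> against the positive arch of \<open>cos (q (y - \<pi>/2))\<close>. Harmonicity gives
  \<open>m'' = q\<^sup>2 m - q \<cdot> (boundary values)\<close>, so that \<open>m'' - q\<^sup>2 m\<close> is bounded above by a multiple of \<open>v\<close>. This
  is Carleman's formula in differential form. As \<open>v\<close> outgrows the homogeneous solution
  \<open>exp (q \<xi>)\<close>, the mean \<open>m\<close> is eventually bounded by a multiple of \<open>v\<close>, with a constant that does not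
  depend on \<open>u\<close>; the initial values of \<open>m\<close> only influence from where on the bound holds
  (\<open>middle_upper_bound\<close>).

  \<^item> Middle line to the whole strip. Adding a constant makes \<open>Re F\<close> positive on a disc about a
  point of the middle line that nearly reaches the boundary, and Harnack's inequality on
  that disc bounds \<open>Re F\<close> above by a multiple of \<open>v / (s\<^sup>3 \<Phi> (s/8))\<close> with \<open>s = sin y\<close>
  (\<open>strip_upper_bound\<close>).

  \<^item> Across the real axis. The last bound blows up at the axis, but integrability of \<open>log\<^sup>- \<Phi>\<close>
  makes the widths of the bands in which it exceeds \<open>4 ^ n\<close> times the wanted bound summable
  (\<open>L_minus_mono_level_widths\<close>). Domar's argument then applies: a point where \<open>u\<close> is too large
  forces, by the mean value inequality on a circle much wider than the band, a nearby point
  where \<open>u\<close> is four times larger, and so on; the steps are summable, and the limit point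
  contradicts upper semicontinuity (\<open>domar_bound\<close>).
\<close>

section \<open>Harmonic functions as real parts of holomorphic functions\<close>

text \<open>
  The second difference is symmetric in the directions \<open>a\<close> and \<open>b\<close>, so using this twice, with the
  roles exchanged, gives the symmetry of mixed second derivatives. By the mean value theorem in
  direction \<open>a\<close> the difference is \<open>t\<close> times an increment of the directional derivative \<open>P\<close>, and
  differentiability of \<open>P\<close> at the single point \<open>z\<close> suffices to evaluate that increment.
\<close>

lemma second_difference_tendsto:
  fixes h P :: "complex \<Rightarrow> real"
  assumes "e > 0"
    and h: "\<And>w. w \<in> ball z e \<Longrightarrow> (h has_derivative H w) (at w)"
    and Ha: "\<And>w. w \<in> ball z e \<Longrightarrow> H w a = P w"
    and P: "(P has_derivative P') (at z)"
  shows "((\<lambda>t::real. (h (z + t *\<^sub>R a + t *\<^sub>R b) - h (z + t *\<^sub>R a) - h (z + t *\<^sub>R b) + h z) / t\<^sup>2)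
    \<longlongrightarrow> P' b) (at_right 0)"
proof (rule tendstoI)
  fix \<epsilon> :: real assume "\<epsilon> > 0"
  define M where "M = norm a + norm b + 1"
  have M: "M > 0" "norm a + norm b < M" "norm a < M" by (auto simp: M_def add_nonneg_pos)
  interpret P': bounded_linear P' using P by (rule has_derivative_bounded_linear)
  define k where "k = \<epsilon> / (4 * M)"
  have "k > 0" using \<open>\<epsilon> > 0\<close> M by (simp add: k_def)
  then obtain d where "d > 0" and d: "\<And>w. norm (w - z) < d \<Longrightarrow>
      norm (P w - P z - P' (w - z)) \<le> k * norm (w - z)"
    using P unfolding has_derivative_at_alt by blast
  define D where "D = min d e / M"
  have "D > 0" using \<open>d > 0\<close> \<open>e > 0\<close> M by (simp add: D_def)
  have "\<forall>\<^sub>F t in at_right (0::real). t \<in> {0<..<D}"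
    using \<open>D > 0\<close> by (intro eventually_at_right_real)
  then show "\<forall>\<^sub>F t in at_right 0. dist ((h (z + t *\<^sub>R a + t *\<^sub>R b) - h (z + t *\<^sub>R a) - h (z + t *\<^sub>R b) + h z) / t\<^sup>2) (P' b) < \<epsilon>"
  proof eventually_elim
    case (elim t)
    then have t: "0 < t" "t < D" by auto
    have small: "norm (s *\<^sub>R a + r *\<^sub>R b) \<le> t * M" "t * M < min d e"
      if "0 \<le> s" "s \<le> t" "0 \<le> r" "r \<le> t" for s r
    proof -
      have "norm (s *\<^sub>R a + r *\<^sub>R b) \<le> s * norm a + r * norm b"
        by (rule order_trans[OF norm_triangle_ineq]) (use that in simp)
      also have "\<dots> \<le> t * norm a + t * norm b"
        using that by (intro add_mono mult_right_mono) auto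
      also have "\<dots> \<le> t * M" using t M by (simp add: distrib_left[symmetric])
      finally show "norm (s *\<^sub>R a + r *\<^sub>R b) \<le> t * M" .
      show "t * M < min d e" using t M by (simp add: D_def pos_less_divide_eq)
    qed
    have inball: "z + s *\<^sub>R a + r *\<^sub>R b \<in> ball z e" 
      if "0 \<le> s" "s \<le> t" "0 \<le> r" "r \<le> t" for s r
      proof -
      have "dist (z + s *\<^sub>R a + r *\<^sub>R b) z = norm (s *\<^sub>R a + r *\<^sub>R b)"
        by (simp add: dist_norm add.assoc)
      then show ?thesis using small[OF that] by (simp add: dist_commute)
    qed
    define \<phi> where "\<phi> = (\<lambda>s. h (z + s *\<^sub>R a + t *\<^sub>R b) - h (z + s *\<^sub>R a))"
    have dphi: "(\<phi> has_field_derivative (P (z + s *\<^sub>R a + t *\<^sub>R b) - P (z + s *\<^sub>R a))) (at s)"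
      if s: "0 \<le> s" "s \<le> t" for s
    proof -
      have line: "((\<lambda>s. h (z + s *\<^sub>R a + r *\<^sub>R b)) has_field_derivative P (z + s *\<^sub>R a + r *\<^sub>R b)) (at s)"
        if r: "0 \<le> r" "r \<le> t" for r
      proof -
        let ?w = "z + s *\<^sub>R a + r *\<^sub>R b"
        have w: "?w \<in> ball z e" using inball[OF s r] .
        have 1: "((\<lambda>s. z + s *\<^sub>R a + r *\<^sub>R b) has_derivative (\<lambda>x. x *\<^sub>R a)) (at s)"
          by (auto intro!: derivative_eq_intros)
        have "((\<lambda>s. h (z + s *\<^sub>R a + r *\<^sub>R b)) has_derivative (\<lambda>x. H ?w (x *\<^sub>R a))) (at s)"
          using has_derivative_compose[OF 1 h[OF w]] by simp
        moreover have "H ?w (x *\<^sub>R a) = P ?w * x" for x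
          using linear_scale[OF has_derivative_linear[OF h[OF w]], of x a] Ha[OF w] by simp
        ultimately show ?thesis by (simp add: has_field_derivative_def)
      qed
      show ?thesis unfolding \<phi>_def
        using DERIV_diff[OF line[of t] line[of 0]] t by simp
    qed
    obtain s where s: "0 < s" "s < t" and eq: "\<phi> t - \<phi> 0 = t * (P (z + s *\<^sub>R a + t *\<^sub>R b) - P (z + s *\<^sub>R a))"
      using MVT2[of 0 t \<phi>, OF _ dphi] t by auto
    let ?R = "\<lambda>w. P w - P z - P' (w - z)"
    have R: "\<bar>?R (z + s *\<^sub>R a + r *\<^sub>R b)\<bar> \<le> k * (t * M)" if "0 \<le> r" "r \<le> t" for r
    proof -
      let ?w = "z + s *\<^sub>R a + r *\<^sub>R b"
      have "?w - z = s *\<^sub>R a + r *\<^sub>R b" by simp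
      then have "norm (?w - z) \<le> t * M" "norm (?w - z) < d" using small[of s r] s that by auto
      then have "\<bar>?R ?w\<bar> \<le> k * norm (?w - z)" using d[OF \<open>norm (?w - z) < d\<close>] by (simp only: real_norm_def)
      also have "\<dots> \<le> k * (t * M)" using \<open>k > 0\<close> \<open>norm (?w - z) \<le> t * M\<close> by (intro mult_left_mono) auto
      finally show ?thesis .
    qed
    have "P (z + s *\<^sub>R a + t *\<^sub>R b) - P (z + s *\<^sub>R a) =
        t * P' b + ?R (z + s *\<^sub>R a + t *\<^sub>R b) - ?R (z + s *\<^sub>R a + 0 *\<^sub>R b)"
      by (simp add: P'.add P'.scaleR add.assoc)
    then have "\<bar>P (z + s *\<^sub>R a + t *\<^sub>R b) - P (z + s *\<^sub>R a) - t * P' b\<bar> \<le> 2 * (k * (t * M))"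
      using R[of t] R[of 0] t by linarith
    then have b1: "\<bar>(P (z + s *\<^sub>R a + t *\<^sub>R b) - P (z + s *\<^sub>R a)) / t - P' b\<bar> \<le> 2 * k * M"
      using t by (simp add: abs_le_iff field_simps)
    have "2 * k * M < \<epsilon>" using \<open>\<epsilon> > 0\<close> M by (simp add: k_def)
    moreover have "(h (z + t *\<^sub>R a + t *\<^sub>R b) - h (z + t *\<^sub>R a) - h (z + t *\<^sub>R b) + h z) / t\<^sup>2
        = (P (z + s *\<^sub>R a + t *\<^sub>R b) - P (z + s *\<^sub>R a)) / t"
    proof -
      have "h (z + t *\<^sub>R a + t *\<^sub>R b) - h (z + t *\<^sub>R a) - h (z + t *\<^sub>R b) + h z
          = t * (P (z + s *\<^sub>R a + t *\<^sub>R b) - P (z + s *\<^sub>R a))"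
        using eq by (simp add: \<phi>_def)
      then show ?thesis using t by (simp add: power2_eq_square)
    qed
    ultimately show ?case using b1 by (simp add: dist_real_def)
  qed
qed

text \<open>
  By symmetry of the mixed derivatives and vanishing of the Laplacian, \<open>h\<^sub>x - \<i> h\<^sub>y\<close> satisfies the
  Cauchy-Riemann equations; on a convex set it has a primitive, whose real part differs from \<open>h\<close>
  by a constant.
\<close>

lemma harmonic_on_convex_imp_Re_holomorphic:
  assumes h: "harmonic_on h U" and S: "open S" "convex S" "S \<subseteq> U"
  obtains f where "f holomorphic_on S" "\<And>z. z \<in> S \<Longrightarrow> Re (f z) = h z"
proof (cases "S = {}")
  case True
  then show ?thesis using that[of "\<lambda>_. 0"] by auto
next
  case False
  then obtain z0 where z0: "z0 \<in> S" by blast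
  obtain hx hy hxx hxy hyx hyy where D: "\<forall>z\<in>U.
      (h has_derivative (\<lambda>w. hx z * Re w + hy z * Im w)) (at z) \<and>
      (hx has_derivative (\<lambda>w. hxx z * Re w + hxy z * Im w)) (at z) \<and>
      (hy has_derivative (\<lambda>w. hyx z * Re w + hyy z * Im w)) (at z) \<and>
      hxx z + hyy z = 0"
    using h unfolding harmonic_on_def by (elim conjE exE) (rule that)
  have dh: "\<And>z. z \<in> S \<Longrightarrow> (h has_derivative (\<lambda>w. hx z * Re w + hy z * Im w)) (at z)"
    and dx: "\<And>z. z \<in> S \<Longrightarrow> (hx has_derivative (\<lambda>w. hxx z * Re w + hxy z * Im w)) (at z)"
    and dy: "\<And>z. z \<in> S \<Longrightarrow> (hy has_derivative (\<lambda>w. hyx z * Re w + hyy z * Im w)) (at z)"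
    and lap: "\<And>z. z \<in> S \<Longrightarrow> hxx z + hyy z = 0"
    using D S(3) by auto
  have sym: "hxy z = hyx z" if zS: "z \<in> S" for z
  proof -
    obtain e where "e > 0" and e: "ball z e \<subseteq> S" using S(1) zS by (meson openE)
    have "((\<lambda>t::real. (h (z + t *\<^sub>R 1 + t *\<^sub>R \<i>) - h (z + t *\<^sub>R 1) - h (z + t *\<^sub>R \<i>) + h z) / t\<^sup>2)
       \<longlongrightarrow> hxx z * Re \<i> + hxy z * Im \<i>) (at_right 0)"
      by (rule second_difference_tendsto[where H = "\<lambda>z w. hx z * Re w + hy z * Im w" and P = hx
            and P' = "\<lambda>w. hxx z * Re w + hxy z * Im w"])
        (use e \<open>e > 0\<close> dh dx[OF zS] in auto)
    moreover have "((\<lambda>t::real. (h (z + t *\<^sub>R \<i> + t *\<^sub>R 1) - h (z + t *\<^sub>R \<i>) - h (z + t *\<^sub>R 1) + h z) / t\<^sup>2)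
       \<longlongrightarrow> hyx z * Re 1 + hyy z * Im 1) (at_right 0)"
      by (rule second_difference_tendsto[where H = "\<lambda>z w. hx z * Re w + hy z * Im w" and P = hy
            and P' = "\<lambda>w. hyx z * Re w + hyy z * Im w"])
        (use e \<open>e > 0\<close> dh dy[OF zS] in auto)
    moreover have "h (z + t *\<^sub>R \<i> + t *\<^sub>R 1) - h (z + t *\<^sub>R \<i>) - h (z + t *\<^sub>R 1) + h z
       = h (z + t *\<^sub>R 1 + t *\<^sub>R \<i>) - h (z + t *\<^sub>R 1) - h (z + t *\<^sub>R \<i>) + h z" for t
      by (simp only: add.assoc add.commute[of "t *\<^sub>R \<i>"])
    ultimately have "hxx z * Re \<i> + hxy z * Im \<i> = hyx z * Re 1 + hyy z * Im 1"
      by (intro tendsto_unique[OF trivial_limit_at_right_real]) auto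
    then show ?thesis by simp
  qed
  define g where "g = (\<lambda>z. Complex (hx z) (- hy z))"
  have dg: "(g has_field_derivative Complex (hxx z) (- hyx z)) (at z)" if "z \<in> S" for z
  proof -
    have "((\<lambda>z. of_real (hx z) - \<i> * of_real (hy z)) has_derivative
        (\<lambda>w. of_real (hxx z * Re w + hxy z * Im w) - \<i> * of_real (hyx z * Re w + hyy z * Im w))) (at z)"
      using dx[OF that] dy[OF that] by (auto intro!: derivative_eq_intros)
    moreover have "(\<lambda>z. of_real (hx z) - \<i> * of_real (hy z)) = g"
      by (simp add: g_def complex_eq_iff fun_eq_iff)
    moreover have "(\<lambda>w. of_real (hxx z * Re w + hxy z * Im w) - \<i> * of_real (hyx z * Re w + hyy z * Im w))
       = (*) (Complex (hxx z) (- hyx z))"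
    proof -
      have "hyy z = - hxx z" using lap[OF that] by linarith
      then show ?thesis using sym[OF that] by (simp add: complex_eq_iff fun_eq_iff algebra_simps)
    qed
    ultimately show ?thesis by (simp add: has_field_derivative_def)
  qed
  then have "g holomorphic_on S"
    by (auto simp: holomorphic_on_def field_differentiable_def intro: has_field_derivative_at_within)
  from holomorphic_convex_primitive'[OF S(2,1) this] obtain f0
    where f0': "\<And>z. z \<in> S \<Longrightarrow> (f0 has_field_derivative g z) (at z within S)" by blast
  have f0: "(f0 has_field_derivative g z) (at z)" if zS: "z \<in> S" for z
    using f0'[OF zS] unfolding at_within_open[OF zS S(1)] .
  have "\<exists>c. \<forall>z\<in>S. Re (f0 z) - h z = c"
  proof (rule has_derivative_zero_constant[OF S(2)])
    fix z assume "z \<in> S"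
    have "((\<lambda>z. Re (f0 z) - h z) has_derivative
       (\<lambda>w. Re (g z * w) - (hx z * Re w + hy z * Im w))) (at z)"
      using has_derivative_diff[OF bounded_linear.has_derivative[OF bounded_linear_Re
            f0[OF \<open>z \<in> S\<close>, unfolded has_field_derivative_def]] dh[OF \<open>z \<in> S\<close>]] .
    then show "((\<lambda>z. Re (f0 z) - h z) has_derivative (\<lambda>w. 0)) (at z within S)"
      by (rule has_derivative_at_withinI[OF has_derivative_eq_rhs]) (simp add: g_def)
  qed
  then obtain c where c: "\<And>z. z \<in> S \<Longrightarrow> Re (f0 z) - h z = c" by blast
  show ?thesis
  proof
    show "(\<lambda>z. f0 z - of_real c) holomorphic_on S"
      by (intro holomorphic_on_diff holomorphic_on_const)
        (auto simp: holomorphic_on_def field_differentiable_def intro: f0')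
    show "Re (f0 z - of_real c) = h z" if "z \<in> S" for z using c[OF that] by simp
  qed
qed

section \<open>Area means over discs\<close>

text \<open>
  The mean value property over discs, with the area integral written as an iterated integral over
  chords, so that bounds on vertical segments can be inserted directly. Integrating a primitive \<open>G\<close>
  of \<open>F\<close> along each chord leaves the difference of \<open>G\<close> at the two end points; the substitution
  \<open>x = Re z - d cos t\<close> turns what remains into a Fourier coefficient of \<open>G\<close> on the circle, that is,
  into \<open>deriv G z = F z\<close>. This is Green's formula for a disc, done by hand.
\<close>

lemma area_integral_over_disc:
  fixes F :: "complex \<Rightarrow> complex"
  assumes F: "F holomorphic_on S" and S: "open S" "convex S" and sub: "cball z d \<subseteq> S" and d: "0 < d"
  defines "Y \<equiv> \<lambda>x. sqrt (d\<^sup>2 - (x - Re z)\<^sup>2)"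
  shows "((\<lambda>x. integral {Im z - Y x .. Im z + Y x} (\<lambda>y. Re (F (Complex x y))))
      has_integral pi * d\<^sup>2 * Re (F z)) {Re z - d .. Re z + d}"
proof -
  from holomorphic_convex_primitive'[OF S(2,1) F] obtain G
    where G': "\<And>w. w \<in> S \<Longrightarrow> (G has_field_derivative F w) (at w within S)" by blast
  have G: "(G has_field_derivative F w) (at w)" if wS: "w \<in> S" for w
    using G'[OF wS] unfolding at_within_open[OF wS S(1)] .
  have holG: "G holomorphic_on S"
    using G by (auto simp: holomorphic_on_def field_differentiable_def intro: has_field_derivative_at_within)
  have contG: "continuous_on S G" using holG by (rule holomorphic_on_imp_continuous_on)
  have in_disc: "Complex x y \<in> cball z d \<longleftrightarrow> (x - Re z)\<^sup>2 + (y - Im z)\<^sup>2 \<le> d\<^sup>2" for x y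
  proof -
    have "Complex x y \<in> cball z d \<longleftrightarrow> sqrt ((x - Re z)\<^sup>2 + (y - Im z)\<^sup>2) \<le> sqrt (d\<^sup>2)"
      using d by (simp add: dist_norm cmod_def power2_commute)
    then show ?thesis by (simp only: real_sqrt_le_iff)
  qed
  have sq: "(x - Re z)\<^sup>2 \<le> d\<^sup>2" if "x \<in> {Re z - d .. Re z + d}" for x
    using that abs_le_square_iff[of "x - Re z" d] d by auto
  have Y: "0 \<le> Y x" "(Y x)\<^sup>2 = d\<^sup>2 - (x - Re z)\<^sup>2" if "x \<in> {Re z - d .. Re z + d}" for x
    using sq[OF that] by (simp_all add: Y_def)
  have seg: "Complex x y \<in> S" if "x \<in> {Re z - d .. Re z + d}" "y \<in> {Im z - Y x .. Im z + Y x}" for x y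
  proof -
    have "(y - Im z)\<^sup>2 \<le> (Y x)\<^sup>2"
      using that Y[OF that(1)] abs_le_square_iff[of "y - Im z" "Y x"] by auto
    then have "Complex x y \<in> cball z d" unfolding in_disc using Y[OF that(1)] by simp
    then show ?thesis using sub by blast
  qed
  define f where "f = (\<lambda>x. - \<i> * (G (Complex x (Im z + Y x)) - G (Complex x (Im z - Y x))))"
  have inner: "((\<lambda>y. F (Complex x y)) has_integral f x) {Im z - Y x .. Im z + Y x}"
    if x: "x \<in> {Re z - d .. Re z + d}" for x
  proof -
    have "((\<lambda>y. - \<i> * G (Complex x y)) has_vector_derivative F (Complex x y)) (at y within T)"
      if "y \<in> {Im z - Y x .. Im z + Y x}" for y T
    proof -
      have 1: "((\<lambda>y. Complex x y) has_vector_derivative \<i>) (at y within T)"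
        by (auto simp: has_vector_derivative_def Complex_eq intro!: derivative_eq_intros)
           (simp add: scaleR_conv_of_real mult.commute)
      have "((\<lambda>w. - \<i> * G w) has_field_derivative - \<i> * F (Complex x y)) (at (Complex x y) within (\<lambda>y. Complex x y) ` T)"
        by (intro DERIV_cmult has_field_derivative_at_within[OF G[OF seg[OF x that]]])
      from field_vector_diff_chain_within[OF 1 this] show ?thesis by (simp add: o_def)
    qed
    then have "((\<lambda>y. F (Complex x y)) has_integral
        (- \<i> * G (Complex x (Im z + Y x)) - - \<i> * G (Complex x (Im z - Y x)))) {Im z - Y x .. Im z + Y x}"
      using Y[OF x] by (intro fundamental_theorem_of_calculus) auto
    then show ?thesis by (simp add: f_def algebra_simps)
  qed
  have contY: "continuous_on A Y" for A unfolding Y_def by (intro continuous_intros)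
  have contf: "continuous_on {Re z - d .. Re z + d} f"
  proof -
    have "continuous_on {Re z - d .. Re z + d} (\<lambda>x. G (Complex x (Im z + Y x)))"
      "continuous_on {Re z - d .. Re z + d} (\<lambda>x. G (Complex x (Im z - Y x)))"
      using Y(1) by (intro continuous_on_compose2[OF contG] continuous_on_Complex continuous_intros contY;
          force intro: seg)+
    then show ?thesis unfolding f_def by (intro continuous_intros)
  qed
  (* psi is the trace of G on the circle, traversed from the leftmost point, times sin t; its
     integral is a multiple of the difference of the Fourier coefficients of G of index 1 and -1. *)
  define \<psi> where "\<psi> = (\<lambda>t. of_real (sin t) * G (z - of_real d * cis t))"
  have circ: "z - of_real d * cis t \<in> S" for t
  proof -
    have "dist z (z - of_real d * cis t) = d" using d by (simp add: dist_norm norm_mult)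
    then show ?thesis using sub by auto
  qed
  have cont\<psi>: "continuous_on A \<psi>" for A
    unfolding \<psi>_def by (intro continuous_intros continuous_on_compose2[OF contG]) (auto intro: circ)
  (* a negative radius shifts the angle by pi, which matches the parametrisation of psi *)
  have path: "circlepath z d = part_circlepath z (- d) (- pi) pi"
    by (simp add: circlepath_def part_circlepath_def fun_eq_iff linepath_def exp_add exp_diff
      ring_distribs exp_minus)
       (simp add: exp_add[symmetric] exp_diff[symmetric] algebra_simps)
  have int0: "(G has_contour_integral 0) (circlepath z d)"
    using holG S sub d by (intro Cauchy_theorem_convex_simple[of G S]) (auto)
  have "((\<lambda>u. G u / (u - z) ^ Suc 1) has_contour_integral ((2 * pi * \<i>) / fact 1 * (deriv ^^ 1) G z)) (circlepath z d)"
    using holG contG sub d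
    by (intro Cauchy_has_contour_integral_higher_derivative_circlepath)
       (auto intro: continuous_on_subset holomorphic_on_subset[OF holG] dest: subset_trans[OF ball_subset_cball])
  moreover have "deriv G z = F z" using d by (intro DERIV_imp_deriv G subsetD[OF sub]) simp
  ultimately have int1: "((\<lambda>u. G u / (u - z)\<^sup>2) has_contour_integral (2 * pi * \<i> * F z)) (circlepath z d)"
    by (simp add: numeral_2_eq_2)
  have "((\<lambda>t. \<psi> t) has_integral (of_real (pi * d) * F z / \<i>)) {-pi..pi}"
  proof -
    have i0: "((\<lambda>t. G (z + of_real (- d) * cis t) * of_real (- d) * \<i> * cis t) has_integral 0) {-pi..pi}"
      using int0 unfolding path by (subst (asm) has_contour_integral_part_circlepath_iff) auto
    have i1: "((\<lambda>t. G (z + of_real (- d) * cis t) / (z + of_real (- d) * cis t - z)\<^sup>2 * of_real (- d) * \<i> * cis t)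
        has_integral (2 * pi * \<i> * F z)) {-pi..pi}"
      using int1 unfolding path by (subst (asm) has_contour_integral_part_circlepath_iff) auto
    have alg: "- \<i> / 2 * (c - inverse c) * g = 1 / (2 * D) * (g * (- D) * \<i> * c)
      - D / 2 * (g / (z + (- D) * c - z)\<^sup>2 * (- D) * \<i> * c)" if "c \<noteq> 0" "D \<noteq> 0" for c D g :: complex
      using that by (simp add: field_simps power2_eq_square)
    have sin: "of_real (sin t) = - \<i> / 2 * (cis t - inverse (cis t))" for t
      by (simp add: complex_eq_iff cis_inverse)
    have eq: "1 / (2 * of_real d) * (G (z + of_real (- d) * cis t) * of_real (- d) * \<i> * cis t)
      - of_real d / 2 * (G (z + of_real (- d) * cis t) / (z + of_real (- d) * cis t - z)\<^sup>2 * of_real (- d) * \<i> * cis t)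
      = \<psi> t" for t
      using alg[of "cis t" "of_real d" "G (z - of_real d * cis t)"] d unfolding \<psi>_def sin by simp
    have "((\<lambda>t. \<psi> t) has_integral (1 / (2 * of_real d) * 0 - of_real d / 2 * (2 * pi * \<i> * F z))) {-pi..pi}"
      by (rule has_integral_eq[OF eq has_integral_diff[OF has_integral_mult_right[OF i0] has_integral_mult_right[OF i1]]])
    then show ?thesis by (simp add: field_simps)
  qed
  moreover have "integral {-pi..pi} \<psi> = integral {-pi..0} \<psi> + integral {0..pi} \<psi>"
    by (rule Henstock_Kurzweil_Integration.integral_combine[symmetric]) (auto intro: integrable_continuous_real cont\<psi>)
  moreover have "integral {-pi..0} \<psi> = integral {0..pi} (\<lambda>t. \<psi> (- t))"
    using Henstock_Kurzweil_Integration.integral_reflect_real[where a = 0 and b = pi and f = "\<lambda>t. \<psi> (- t)"]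
    by (simp del: Henstock_Kurzweil_Integration.integral_reflect_real)
  ultimately have "integral {0..pi} (\<lambda>t. \<psi> (- t) + \<psi> t) = of_real (pi * d) * F z / \<i>"
    by (subst integral_add)
      (auto intro!: integrable_continuous_real cont\<psi> continuous_on_compose2[OF cont\<psi>] continuous_intros
        simp: has_integral_iff)
  then have psi: "((\<lambda>t. \<psi> (- t) + \<psi> t) has_integral of_real (pi * d) * F z / \<i>) {0..pi}"
    by (auto simp: has_integral_iff intro!: integrable_continuous_real continuous_intros cont\<psi> continuous_on_compose2[OF cont\<psi>])
  have "((\<lambda>t. (d * sin t) *\<^sub>R f (Re z - d * cos t)) has_integral integral {Re z - d * cos 0..Re z - d * cos pi} f) {0..pi}"
  proof (rule has_integral_substitution[where c = "Re z - d" and d = "Re z + d"])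
    show "(\<lambda>t. Re z - d * cos t) ` {0..pi} \<subseteq> {Re z - d..Re z + d}"
    proof -
      have "\<bar>d * cos t\<bar> \<le> d" for t using d by (simp add: abs_mult mult_left_le)
      then show ?thesis by (force simp: abs_le_iff)
    qed
  qed (use d contf in \<open>auto intro!: derivative_eq_intros\<close>)
  then have "((\<lambda>t. (d * sin t) *\<^sub>R f (Re z - d * cos t)) has_integral integral {Re z - d..Re z + d} f) {0..pi}"
    by simp
  moreover have "((\<lambda>t. (d * sin t) *\<^sub>R f (Re z - d * cos t)) has_integral (\<i> * of_real d * (of_real (pi * d) * F z / \<i>))) {0..pi}"
  proof (rule has_integral_eq[OF _ has_integral_mult_right[OF psi]])
    fix t assume t: "t \<in> {0..pi}"
    have "Y (Re z - d * cos t) = sqrt ((d * sin t)\<^sup>2)"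
      by (simp add: Y_def power_mult_distrib sin_squared_eq algebra_simps)
    then have Yt: "Y (Re z - d * cos t) = d * sin t"
      using t d by (simp add: sin_ge_zero)
    have pts: "Complex (Re z - d * cos t) (Im z + d * sin t) = z - of_real d * cis (- t)"
      "Complex (Re z - d * cos t) (Im z - d * sin t) = z - of_real d * cis t"
      by (simp_all add: complex_eq_iff)
    show "\<i> * of_real d * (\<psi> (- t) + \<psi> t) = (d * sin t) *\<^sub>R f (Re z - d * cos t)"
      unfolding f_def Yt \<psi>_def pts by (simp add: scaleR_conv_of_real algebra_simps)
  qed
  ultimately have "integral {Re z - d..Re z + d} f = \<i> * of_real d * (of_real (pi * d) * F z / \<i>)"
    by (rule has_integral_unique)
  moreover have "k * D * (X / k) = D * X" if "k \<noteq> 0" for k D X :: complex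
    using that by simp
  ultimately have "integral {Re z - d..Re z + d} f = of_real d * (of_real (pi * d) * F z)"
    by (simp only: complex_i_not_zero not_False_eq_True)
  then have "integral {Re z - d..Re z + d} f = of_real (pi * d\<^sup>2) * F z"
    by (simp add: power2_eq_square mult_ac)
  then have "(f has_integral of_real (pi * d\<^sup>2) * F z) {Re z - d..Re z + d}"
    using integrable_integral[OF integrable_continuous_real[OF contf]] by simp
  then have "((\<lambda>x. Re (f x)) has_integral pi * d\<^sup>2 * Re (F z)) {Re z - d..Re z + d}"
    by (auto dest: has_integral_Re)
  then show ?thesis
    by (rule has_integral_eq[rotated]) (rule integral_unique[OF has_integral_Re[OF inner], symmetric])
qed

lemma chord_in_disc:
  assumes "\<bar>x - Re z\<bar> \<le> d" "\<bar>y - Im z\<bar> \<le> sqrt (d\<^sup>2 - (x - Re z)\<^sup>2)"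
  shows "Complex x y \<in> cball z d"
proof -
  have d: "0 \<le> d" using assms(1) by linarith
  have "(x - Re z)\<^sup>2 \<le> d\<^sup>2" using assms(1) d by (simp add: abs_le_square_iff[symmetric])
  moreover have "(y - Im z)\<^sup>2 \<le> (sqrt (d\<^sup>2 - (x - Re z)\<^sup>2))\<^sup>2"
    using assms(2) by (rule abs_le_square_iff[THEN iffD1, OF order_trans[OF _ abs_ge_self]])
  ultimately have "(x - Re z)\<^sup>2 + (y - Im z)\<^sup>2 \<le> d\<^sup>2" by simp
  then have "sqrt ((x - Re z)\<^sup>2 + (y - Im z)\<^sup>2) \<le> d" by (rule real_le_lsqrt[OF d])
  then show ?thesis by (simp add: dist_norm cmod_def power2_commute)
qed

lemma in_disc_chord:
  assumes "Complex x y \<in> cball z d"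
  shows "\<bar>x - Re z\<bar> \<le> d" "\<bar>y - Im z\<bar> \<le> sqrt (d\<^sup>2 - (x - Re z)\<^sup>2)"
proof -
  have le: "cmod (Complex x y - z) \<le> d" using assms by (simp add: dist_norm norm_minus_commute)
  then show "\<bar>x - Re z\<bar> \<le> d" using abs_Re_le_cmod[of "Complex x y - z"] by simp
  have "(cmod (Complex x y - z))\<^sup>2 \<le> d\<^sup>2" using le by (intro power_mono) auto
  then have "(y - Im z)\<^sup>2 \<le> d\<^sup>2 - (x - Re z)\<^sup>2" by (simp add: cmod_power2)
  then show "\<bar>y - Im z\<bar> \<le> sqrt (d\<^sup>2 - (x - Re z)\<^sup>2)"
    using real_sqrt_le_mono by fastforce
qed

lemma chord_nonneg: "\<bar>x - Re z\<bar> \<le> d \<Longrightarrow> 0 \<le> sqrt (d\<^sup>2 - (x - Re z)\<^sup>2)"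
  by (simp add: abs_le_square_iff[symmetric])

lemma continuous_on_vertical:
  assumes "F holomorphic_on S" "\<And>y. y \<in> A \<Longrightarrow> Complex x y \<in> S"
  shows "continuous_on A (\<lambda>y. Re (F (Complex x y)))"
  by (intro continuous_on_Re continuous_on_compose2[OF holomorphic_on_imp_continuous_on[OF assms(1)]]
      continuous_on_Complex continuous_intros) (use assms(2) in auto)

text \<open>
  A bound for the mass of the positive part on every vertical segment, uniform in the position of
  the segment, bounds the function at the centre of the disc. Applied to \<open>- F\<close> this gives lower bounds.
\<close>

lemma Re_holomorphic_le_chord_bound:
  assumes F: "F holomorphic_on S" "open S" "convex S" and sub: "cball z d \<subseteq> S" and d: "0 < d"
    and C: "\<And>x a b. \<bar>x - Re z\<bar> \<le> d \<Longrightarrow> Im z - d \<le> a \<Longrightarrow> a \<le> b \<Longrightarrow> b \<le> Im z + d \<Longrightarrow>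
      (\<And>y. y \<in> {a..b} \<Longrightarrow> Complex x y \<in> S) \<Longrightarrow>
      integral {a..b} (\<lambda>y. max (Re (F (Complex x y))) 0) \<le> C"
  shows "pi * d * Re (F z) \<le> 2 * C"
proof -
  have "pi * d\<^sup>2 * Re (F z) \<le> C * (Re z + d - (Re z - d))"
  proof (rule has_integral_le[OF area_integral_over_disc[OF F sub d]])
    show "((\<lambda>x. C) has_integral C * (Re z + d - (Re z - d))) {Re z - d..Re z + d}"
      using has_integral_const_real[of C "Re z - d" "Re z + d"] d by (simp add: mult.commute)
    fix x assume x: "x \<in> {Re z - d..Re z + d}"
    define Y where "Y = sqrt (d\<^sup>2 - (x - Re z)\<^sup>2)"
    have x': "\<bar>x - Re z\<bar> \<le> d" using x by auto
    have Y: "0 \<le> Y" using chord_nonneg[OF x'] by (simp add: Y_def)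
    have "Y \<le> sqrt (d\<^sup>2)" unfolding Y_def by (rule real_sqrt_le_mono) simp
    then have Yd: "Y \<le> d" using d by simp
    have inS: "Complex x y \<in> S" if "y \<in> {Im z - Y..Im z + Y}" for y
      using chord_in_disc[OF x', of y] that sub by (auto simp: Y_def)
    have cont: "continuous_on {Im z - Y..Im z + Y} (\<lambda>y. Re (F (Complex x y)))"
      using F(1) inS by (rule continuous_on_vertical)
    have "integral {Im z - Y..Im z + Y} (\<lambda>y. Re (F (Complex x y)))
        \<le> integral {Im z - Y..Im z + Y} (\<lambda>y. max (Re (F (Complex x y))) 0)"
      by (intro integral_le integrable_continuous_real continuous_intros cont) auto
    also have "\<dots> \<le> C" using Y Yd inS by (intro C[OF x']) auto
    finally show "integral {Im z - sqrt (d\<^sup>2 - (x - Re z)\<^sup>2)..Im z + sqrt (d\<^sup>2 - (x - Re z)\<^sup>2)}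
        (\<lambda>y. Re (F (Complex x y))) \<le> C" by (simp add: Y_def)
  qed
  then have "d * (pi * d * Re (F z)) \<le> d * (2 * C)" by (simp add: power2_eq_square algebra_simps)
  then show ?thesis using d by simp
qed

text \<open>
  Harnack's inequality in the weak form that the area mean gives at once: for a nonnegative
  function the integral over the smaller disc is at most the integral over the larger one. The
  centres have the same real part so that each chord of the smaller disc lies in a chord of the
  larger one.
\<close>

lemma nested_disc_harnack:
  assumes F: "F holomorphic_on S" "open S" "convex S" and sub: "cball z2 d2 \<subseteq> S"
    and d: "0 < d1" "dist z1 z2 + d1 \<le> d2" and re: "Re z1 = Re z2"
    and pos: "\<And>w. w \<in> cball z2 d2 \<Longrightarrow> 0 \<le> Re (F w)"
  shows "d1\<^sup>2 * Re (F z1) \<le> d2\<^sup>2 * Re (F z2)"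
proof -
  have nest: "cball z1 d1 \<subseteq> cball z2 d2" using d by (simp add: cball_subset_cball_iff)
  have d2: "0 < d2" "d1 \<le> d2" using d zero_le_dist[of z1 z2] by linarith+
  define Y where "Y = (\<lambda>d x. sqrt (d\<^sup>2 - (x - Re z2)\<^sup>2))"
  define J where "J = (\<lambda>z d x. integral {Im z - Y d x .. Im z + Y d x} (\<lambda>y. Re (F (Complex x y))))"
  have J1: "(J z1 d1 has_integral pi * d1\<^sup>2 * Re (F z1)) {Re z2 - d1 .. Re z2 + d1}"
    using area_integral_over_disc[OF F order_trans[OF nest sub] d(1)] by (simp add: J_def Y_def re)
  have J2: "(J z2 d2 has_integral pi * d2\<^sup>2 * Re (F z2)) {Re z2 - d2 .. Re z2 + d2}"
    using area_integral_over_disc[OF F sub d2(1)] by (simp add: J_def Y_def)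
  have chord2: "Complex x y \<in> cball z2 d2" if "\<bar>x - Re z2\<bar> \<le> d2" "y \<in> {Im z2 - Y d2 x .. Im z2 + Y d2 x}" for x y
    using chord_in_disc[OF that(1), of y] that(2) by (auto simp: Y_def)
  have int2: "(\<lambda>y. Re (F (Complex x y))) integrable_on {Im z2 - Y d2 x .. Im z2 + Y d2 x}"
    if "\<bar>x - Re z2\<bar> \<le> d2" for x
    using chord2[OF that] sub by (intro integrable_continuous_real continuous_on_vertical[OF F(1)]) auto
  have J2_nonneg: "0 \<le> J z2 d2 x" if "\<bar>x - Re z2\<bar> \<le> d2" for x
    unfolding J_def by (rule integral_nonneg[OF int2[OF that]]) (use pos chord2[OF that] in auto)
  have J12: "J z1 d1 x \<le> J z2 d2 x" if x: "\<bar>x - Re z2\<bar> \<le> d1" for x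
  proof -
    have x2: "\<bar>x - Re z2\<bar> \<le> d2" using x d2 by simp
    have sub12: "{Im z1 - Y d1 x .. Im z1 + Y d1 x} \<subseteq> {Im z2 - Y d2 x .. Im z2 + Y d2 x}"
    proof
      fix y assume "y \<in> {Im z1 - Y d1 x .. Im z1 + Y d1 x}"
      then have "Complex x y \<in> cball z1 d1" using chord_in_disc[of x z1 d1 y] x by (auto simp: re Y_def)
      then have "Complex x y \<in> cball z2 d2" using nest by blast
      then show "y \<in> {Im z2 - Y d2 x .. Im z2 + Y d2 x}" using in_disc_chord(2)[of x y z2 d2] by (auto simp: Y_def)
    qed
    show ?thesis unfolding J_def
      using sub12 int2[OF x2] chord2[OF x2] pos
      by (intro integral_subset_le) (auto intro: integrable_on_subinterval)
  qed
  have "integral {Re z2 - d1 .. Re z2 + d1} (J z1 d1) \<le> integral {Re z2 - d1 .. Re z2 + d1} (J z2 d2)"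
    using J1 J2 d2 by (intro integral_le J12) (auto intro: integrable_on_subinterval)
  also have "\<dots> \<le> integral {Re z2 - d2 .. Re z2 + d2} (J z2 d2)"
    using J2 d2 by (intro integral_subset_le) (auto intro: integrable_on_subinterval intro!: J2_nonneg simp: abs_le_iff)
  finally have "pi * d1\<^sup>2 * Re (F z1) \<le> pi * d2\<^sup>2 * Re (F z2)"
    using J1 J2 by (simp add: has_integral_iff)
  then show ?thesis by (simp add: mult.assoc)
qed

section \<open>Carleman's formula in a strip\<close>

text \<open>
  The operator factors as \<open>(d/dt - q) (d/dt + q)\<close>. After subtracting the particular solution
  \<open>E exp (p t)\<close> both first-order inequalities are integrated in turn by means of the factors
  \<open>exp (- q t)\<close> and \<open>exp (q t)\<close>; this produces the homogeneous solution \<open>exp (q t)\<close> with a constant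
  determined by the data at the left end point.
\<close>

lemma second_order_comparison:
  fixes m m' m'' :: "real \<Rightarrow> real"
  assumes m: "\<And>t. t \<in> {a..b} \<Longrightarrow> (m has_real_derivative m' t) (at t)"
    and dm': "\<And>t. t \<in> {a..b} \<Longrightarrow> (m' has_real_derivative m'' t) (at t)"
    and le: "\<And>t. t \<in> {a..b} \<Longrightarrow> m'' t - q\<^sup>2 * m t \<le> D * exp (p * t)"
    and q: "0 < q" "q < p" and "0 \<le> D" "a \<le> b"
  shows "m b \<le> (\<bar>m a\<bar> + \<bar>m' a + q * m a\<bar> / (2 * q)) * exp (q * (b - a)) + D / (p\<^sup>2 - q\<^sup>2) * exp (p * b)"
proof -
  have pq: "0 < p\<^sup>2 - q\<^sup>2" using q power_strict_mono[of q p 2] by simp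
  define E where "E = D / (p\<^sup>2 - q\<^sup>2)"
  have E: "0 \<le> E" "E * (p\<^sup>2 - q\<^sup>2) = D" using pq \<open>0 \<le> D\<close> by (auto simp: E_def)
  define n where "n = (\<lambda>t. m t - E * exp (p * t))"
  define g where "g = (\<lambda>t. m' t - E * p * exp (p * t) + q * n t)"
  define k where "k = \<bar>m' a + q * m a\<bar>"
  have dn: "(n has_real_derivative m' t - E * p * exp (p * t)) (at t)" if "t \<in> {a..b}" for t
    unfolding n_def using m[OF that] by (auto intro!: derivative_eq_intros)
  have dg: "(g has_real_derivative m'' t - E * p\<^sup>2 * exp (p * t) + q * (m' t - E * p * exp (p * t))) (at t)"
    if "t \<in> {a..b}" for t
    unfolding g_def using dm'[OF that] dn[OF that] by (auto intro!: derivative_eq_intros simp: power2_eq_square)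
  have g_le: "m'' t - E * p\<^sup>2 * exp (p * t) + q * (m' t - E * p * exp (p * t)) - q * g t \<le> 0" if "t \<in> {a..b}" for t
  proof -
    have "m'' t - E * p\<^sup>2 * exp (p * t) + q * (m' t - E * p * exp (p * t)) - q * g t
        = (m'' t - q\<^sup>2 * m t) - E * (p\<^sup>2 - q\<^sup>2) * exp (p * t)"
      by (simp add: g_def n_def algebra_simps power2_eq_square)
    then show ?thesis using le[OF that] E by simp
  qed
  have ga: "g a \<le> k"
  proof -
    have "g a = m' a + q * m a - (E * p * exp (p * a) + q * (E * exp (p * a)))"
      by (simp add: g_def n_def algebra_simps)
    moreover have "0 \<le> E * p * exp (p * a) + q * (E * exp (p * a))" using E q by simp
    ultimately show ?thesis unfolding k_def by linarith
  qed
  have g_bound: "g t \<le> k * exp (q * (t - a))" if t: "t \<in> {a..b}" for t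
  proof -
    have "exp (- q * t) * g t \<le> exp (- q * a) * g a"
    proof (rule DERIV_nonpos_imp_nonincreasing[where f = "\<lambda>t. exp (- q * t) * g t"])
      show "a \<le> t" using t by simp
      fix x assume "a \<le> x" "x \<le> t"
      then have x: "x \<in> {a..b}" using t by simp
      show "\<exists>y. ((\<lambda>t. exp (- q * t) * g t) has_real_derivative y) (at x) \<and> y \<le> 0"
      proof (intro exI conjI)
        let ?d = "m'' x - E * p\<^sup>2 * exp (p * x) + q * (m' x - E * p * exp (p * x))"
        show "((\<lambda>t. exp (- q * t) * g t) has_real_derivative exp (- q * x) * (?d - q * g x)) (at x)"
          by (auto intro!: derivative_eq_intros dg[OF x] simp: algebra_simps)
        show "exp (- q * x) * (?d - q * g x) \<le> 0"
          using g_le[OF x] by (intro mult_nonneg_nonpos) auto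
      qed
    qed
    also have "\<dots> \<le> exp (- q * a) * k" using ga by simp
    finally have "exp (q * t) * (exp (- q * t) * g t) \<le> exp (q * t) * (exp (- q * a) * k)" by simp
    then show ?thesis by (simp add: exp_minus exp_diff right_diff_distrib field_simps)
  qed
  have "exp (q * b) * n b - k / (2 * q) * exp (q * (2 * b - a)) \<le> exp (q * a) * n a - k / (2 * q) * exp (q * (2 * a - a))"
  proof (rule DERIV_nonpos_imp_nonincreasing[OF \<open>a \<le> b\<close>,
      where f = "\<lambda>x. exp (q * x) * n x - k / (2 * q) * exp (q * (2 * x - a))"])
    fix x assume "a \<le> x" "x \<le> b"
    then have x: "x \<in> {a..b}" by simp
    have "exp (q * x) * g x \<le> exp (q * x) * (k * exp (q * (x - a)))" using g_bound[OF x] by simp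
    also have "\<dots> = k * exp (q * (2 * x - a))" by (simp add: exp_add[symmetric] algebra_simps)
    finally have "exp (q * x) * g x - k * exp (q * (2 * x - a)) \<le> 0" by simp
    moreover have "((\<lambda>x. exp (q * x) * n x - k / (2 * q) * exp (q * (2 * x - a))) has_real_derivative
        exp (q * x) * g x - k * exp (q * (2 * x - a))) (at x)"
      using q by (auto intro!: derivative_eq_intros dn[OF x] simp: g_def algebra_simps)
    ultimately show "\<exists>y. ((\<lambda>x. exp (q * x) * n x - k / (2 * q) * exp (q * (2 * x - a))) has_real_derivative y) (at x) \<and> y \<le> 0"
      by blast
  qed
  moreover have "0 \<le> k" by (simp add: k_def)
  moreover have "n a \<le> \<bar>m a\<bar>" using E by (auto simp: n_def intro: order_trans[OF _ abs_ge_self])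
  ultimately have "exp (q * b) * n b \<le> exp (q * a) * \<bar>m a\<bar> + k / (2 * q) * exp (q * (2 * b - a))"
    using q by (smt (verit) divide_nonneg_pos exp_gt_zero mult_left_mono mult_nonneg_nonneg)
  also have "\<dots> \<le> exp (q * (2 * b - a)) * \<bar>m a\<bar> + k / (2 * q) * exp (q * (2 * b - a))"
    using q \<open>a \<le> b\<close> by (intro add_right_mono mult_right_mono) auto
  also have "\<dots> = exp (q * b) * ((\<bar>m a\<bar> + k / (2 * q)) * exp (q * (b - a)))"
    by (simp add: exp_add[symmetric] algebra_simps)
  finally have "n b \<le> (\<bar>m a\<bar> + k / (2 * q)) * exp (q * (b - a))" by simp
  then show ?thesis by (simp add: n_def k_def E_def)
qed

abbreviation strip :: "complex set" where
  "strip \<equiv> {w. 0 < Im w \<and> Im w < pi}"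

lemma open_strip: "open strip" and convex_strip: "convex strip"
proof -
  have "strip = {w. 0 < Im w} \<inter> {w. Im w < pi}" by auto
  then show "open strip" "convex strip"
    by (auto intro!: open_Int convex_Int open_halfspace_Im_gt open_halfspace_Im_lt
        convex_halfspace_Im_gt convex_halfspace_Im_lt)
qed

text \<open>
  The mean against the arch of \<open>cos (q t)\<close>, where \<open>t = y - \<pi>/2\<close>, over the interval on which the cosine
  is nonnegative. The argument \<open>\<zeta>\<close> is complex so that differentiation under the integral sign can be
  done for holomorphic integrands; only real values of \<open>\<zeta>\<close> matter.
\<close>

definition cos_mean :: "real \<Rightarrow> (complex \<Rightarrow> complex) \<Rightarrow> complex \<Rightarrow> complex" where
  "cos_mean q F \<zeta> = integral {- (pi / (2 * q)) .. pi / (2 * q)}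
     (\<lambda>t. F (\<zeta> + \<i> * of_real (pi / 2 + t)) * of_real (cos (q * t)))"

lemma in_strip_around_middle:
  assumes "1 < q" "\<bar>t\<bar> \<le> pi / (2 * q)" "\<bar>Im \<zeta>\<bar> < pi / 2 - pi / (2 * q)"
  shows "\<zeta> + \<i> * of_real (pi / 2 + t) \<in> strip"
proof -
  have "\<bar>Im \<zeta> + t\<bar> < pi / 2" using assms(2,3) by linarith
  then have "0 < Im \<zeta> + (pi / 2 + t)" "Im \<zeta> + (pi / 2 + t) < pi" by linarith+
  then show ?thesis by simp
qed

lemma continuous_on_around_middle:
  assumes "F holomorphic_on strip" "1 < q"
  shows "continuous_on ({\<zeta>. \<bar>Im \<zeta>\<bar> < pi / 2 - pi / (2 * q)} \<times> {- (pi / (2 * q)) .. pi / (2 * q)})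
    (\<lambda>(\<zeta>, t). F (\<zeta> + \<i> * of_real (pi / 2 + t)) * of_real (cos (q * t)))"
proof -
  let ?A = "{\<zeta>. \<bar>Im \<zeta>\<bar> < pi / 2 - pi / (2 * q)} \<times> {- (pi / (2 * q)) .. pi / (2 * q)}"
  have "continuous_on ?A (\<lambda>x. F (fst x + \<i> * of_real (pi / 2 + snd x)))"
  proof (rule continuous_on_compose2[OF holomorphic_on_imp_continuous_on[OF assms(1)]])
    show "continuous_on ?A (\<lambda>x. fst x + \<i> * of_real (pi / 2 + snd x))"
      by (intro continuous_on_add continuous_on_mult continuous_on_of_real continuous_on_fst
          continuous_on_snd continuous_on_const continuous_on_id)
    show "(\<lambda>x. fst x + \<i> * of_real (pi / 2 + snd x)) ` ?A \<subseteq> strip"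
    proof (rule image_subsetI)
      fix x assume "x \<in> ?A"
      then have "\<bar>snd x\<bar> \<le> pi / (2 * q)" "\<bar>Im (fst x)\<bar> < pi / 2 - pi / (2 * q)"
        by (auto simp only: mem_Times_iff mem_Collect_eq atLeastAtMost_iff abs_le_iff)
      then show "fst x + \<i> * of_real (pi / 2 + snd x) \<in> strip"
        by (rule in_strip_around_middle[OF assms(2)])
    qed
  qed
  moreover have "continuous_on ?A (\<lambda>x. complex_of_real (cos (q * snd x)))"
    by (intro continuous_on_of_real continuous_on_cos continuous_on_mult continuous_on_const
        continuous_on_snd continuous_on_id)
  ultimately show ?thesis unfolding case_prod_unfold by (rule continuous_on_mult)
qed

lemma cos_mean_derivative:
  assumes F: "F holomorphic_on strip" and q: "1 < q"
  shows "((\<lambda>x. Re (cos_mean q F (of_real x))) has_real_derivative Re (cos_mean q (deriv F) (of_real x))) (at x)"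
proof -
  define U where "U = {\<zeta>. \<bar>Im \<zeta>\<bar> < pi / 2 - pi / (2 * q)}"
  have "U = {\<zeta>. Im \<zeta> < pi / 2 - pi / (2 * q)} \<inter> {\<zeta>. - (pi / 2 - pi / (2 * q)) < Im \<zeta>}"
    by (auto simp: U_def)
  then have "convex U" "open U"
    by (auto intro!: convex_Int open_Int convex_halfspace_Im_gt convex_halfspace_Im_lt
        open_halfspace_Im_gt open_halfspace_Im_lt)
  have xU: "of_real x \<in> U" using q by (simp add: U_def field_simps)
  have "((\<lambda>\<zeta>. integral (cbox (- (pi / (2 * q))) (pi / (2 * q))) (\<lambda>t. F (\<zeta> + \<i> * of_real (pi / 2 + t)) * of_real (cos (q * t))))
     has_field_derivative integral (cbox (- (pi / (2 * q))) (pi / (2 * q)))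
       (\<lambda>t. deriv F (of_real x + \<i> * of_real (pi / 2 + t)) * of_real (cos (q * t)))) (at (of_real x) within U)"
  proof (rule leibniz_rule_field_derivative[OF _ _ _ xU \<open>convex U\<close>])
    fix \<zeta> t assume \<zeta>: "\<zeta> \<in> U" and t: "t \<in> cbox (- (pi / (2 * q))) (pi / (2 * q))"
    have "\<zeta> + \<i> * of_real (pi / 2 + t) \<in> strip"
      using \<zeta> t q by (intro in_strip_around_middle) (auto simp: U_def abs_le_iff)
    then have d: "(F has_field_derivative deriv F (\<zeta> + \<i> * of_real (pi / 2 + t))) (at (\<zeta> + \<i> * of_real (pi / 2 + t)))"
      by (rule holomorphic_derivI[OF F open_strip])
    have "((\<lambda>\<zeta>. F (\<zeta> + \<i> * of_real (pi / 2 + t))) has_field_derivative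
        deriv F (\<zeta> + \<i> * of_real (pi / 2 + t)) * 1) (at \<zeta> within U)"
      by (rule DERIV_chain2[where g = "\<lambda>\<zeta>. \<zeta> + \<i> * of_real (pi / 2 + t)", OF d])
         (auto intro!: derivative_eq_intros)
    then show "((\<lambda>\<zeta>. F (\<zeta> + \<i> * of_real (pi / 2 + t)) * of_real (cos (q * t))) has_field_derivative
       deriv F (\<zeta> + \<i> * of_real (pi / 2 + t)) * of_real (cos (q * t))) (at \<zeta> within U)"
      by (auto intro!: derivative_eq_intros)
  next
    fix \<zeta> assume \<zeta>: "\<zeta> \<in> U"
    have "continuous_on (cbox (- (pi / (2 * q))) (pi / (2 * q)))
      (\<lambda>t. (\<lambda>(\<zeta>, t). F (\<zeta> + \<i> * of_real (pi / 2 + t)) * of_real (cos (q * t))) (\<zeta>, t))"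
      by (rule continuous_on_compose2[OF continuous_on_around_middle[OF F q]])
         (use \<zeta> in \<open>auto simp: U_def intro!: continuous_intros\<close>)
    then show "(\<lambda>t. F (\<zeta> + \<i> * of_real (pi / 2 + t)) * of_real (cos (q * t))) integrable_on
        cbox (- (pi / (2 * q))) (pi / (2 * q))"
      by (intro integrable_continuous) simp
  next
    show "continuous_on (U \<times> cbox (- (pi / (2 * q))) (pi / (2 * q)))
      (\<lambda>(\<zeta>, t). deriv F (\<zeta> + \<i> * of_real (pi / 2 + t)) * of_real (cos (q * t)))"
      using continuous_on_around_middle[OF holomorphic_deriv[OF F open_strip] q] by (simp add: U_def)
  qed
  then have "(cos_mean q F has_field_derivative cos_mean q (deriv F) (of_real x)) (at (of_real x))"
    unfolding cos_mean_def[abs_def] at_within_open[OF xU \<open>open U\<close>] by simp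
  then have "((\<lambda>x. cos_mean q F (of_real x)) has_vector_derivative cos_mean q (deriv F) (of_real x)) (at x)"
    by (rule has_vector_derivative_real_field)
  then show ?thesis
    unfolding has_real_derivative_iff_has_vector_derivative
    by (rule bounded_linear.has_vector_derivative[OF bounded_linear_Re])
qed

text \<open>
  Along a vertical line two integrations by parts move the second derivative of \<open>F\<close> to the cosine,
  which reproduces itself up to the factor \<open>- q\<^sup>2\<close>. The cosine vanishes at the ends of the arch, so only
  the values of \<open>F\<close> itself, and not those of its derivative, survive there.
\<close>

lemma cos_mean_second_derivative:
  assumes F: "F holomorphic_on strip" and q: "1 < q"
  shows "Re (cos_mean q (deriv (deriv F)) (of_real x)) = q\<^sup>2 * Re (cos_mean q F (of_real x))
     - q * (Re (F (Complex x (pi / 2 + pi / (2 * q)))) + Re (F (Complex x (pi / 2 - pi / (2 * q)))))"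
proof -
  define \<beta> where "\<beta> = pi / (2 * q)"
  have \<beta>: "0 < \<beta>" "\<beta> < pi / 2" "q * \<beta> = pi / 2"
  proof -
    show "0 < \<beta>" using q by (simp add: \<beta>_def)
    show "q * \<beta> = pi / 2" using q by (simp add: \<beta>_def)
    then show "\<beta> < pi / 2" using mult_strict_right_mono[OF q \<open>0 < \<beta>\<close>] by linarith
  qed
  define p where "p = (\<lambda>t. complex_of_real x + \<i> * of_real (pi / 2 + t))"
  have p: "p t \<in> strip" if "t \<in> {-\<beta>..\<beta>}" for t using that \<beta> by (auto simp: p_def)
  have dF: "deriv F holomorphic_on strip" by (rule holomorphic_deriv[OF F open_strip])
  have ddF: "deriv (deriv F) holomorphic_on strip" by (rule holomorphic_deriv[OF dF open_strip])
  have dG: "((\<lambda>t. G (p t)) has_vector_derivative \<i> * deriv G (p t)) (at t within T)"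
    if G: "G holomorphic_on strip" and t: "t \<in> {-\<beta>..\<beta>}" for G t T
  proof -
    have "((\<lambda>t. complex_of_real (pi / 2 + t)) has_vector_derivative of_real 1) (at t within T)"
      by (rule has_vector_derivative_of_real) (auto intro!: derivative_eq_intros)
    from has_vector_derivative_add[OF has_vector_derivative_const has_vector_derivative_mult_right[OF this]]
    have 1: "(p has_vector_derivative \<i>) (at t within T)" unfolding p_def by simp
    have "(G has_field_derivative deriv G (p t)) (at (p t) within p ` T)"
      by (rule has_field_derivative_at_within[OF holomorphic_derivI[OF G open_strip p[OF t]]])
    from field_vector_diff_chain_within[OF 1 this] show ?thesis by (simp add: o_def)
  qed
  (* the antiderivative produced by the two integrations by parts *)
  have "((\<lambda>t. q\<^sup>2 * (F (p t) * of_real (cos (q * t))) - deriv (deriv F) (p t) * of_real (cos (q * t))) has_integral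
     (\<i> * deriv F (p \<beta>) * of_real (cos (q * \<beta>)) + q * F (p \<beta>) * of_real (sin (q * \<beta>)))
     - (\<i> * deriv F (p (-\<beta>)) * of_real (cos (q * (-\<beta>))) + q * F (p (-\<beta>)) * of_real (sin (q * (-\<beta>))))) {-\<beta>..\<beta>}"
  proof (rule fundamental_theorem_of_calculus)
    fix t assume t: "t \<in> {-\<beta>..\<beta>}"
    have c: "((\<lambda>t. complex_of_real (cos (q * t))) has_vector_derivative of_real (- q * sin (q * t))) (at t within {-\<beta>..\<beta>})"
      "((\<lambda>t. complex_of_real (sin (q * t))) has_vector_derivative of_real (q * cos (q * t))) (at t within {-\<beta>..\<beta>})"
      by (rule has_vector_derivative_of_real; auto intro!: derivative_eq_intros)+
    have "((\<lambda>t. \<i> * deriv F (p t) * of_real (cos (q * t)) + q * F (p t) * of_real (sin (q * t))) has_vector_derivative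
      (\<i> * deriv F (p t)) * of_real (- q * sin (q * t)) + (\<i> * (\<i> * deriv (deriv F) (p t))) * of_real (cos (q * t))
      + ((q * F (p t)) * of_real (q * cos (q * t)) + (q * (\<i> * deriv F (p t))) * of_real (sin (q * t)))) (at t within {-\<beta>..\<beta>})"
      using has_vector_derivative_add[OF
          has_vector_derivative_mult[OF has_vector_derivative_mult_right[OF dG[OF dF t], of \<i>] c(1)]
          has_vector_derivative_mult[OF has_vector_derivative_mult_right[OF dG[OF F t], of "of_real q"] c(2)]] .
    moreover have "(\<i> * deriv F (p t)) * of_real (- q * sin (q * t)) + (\<i> * (\<i> * deriv (deriv F) (p t))) * of_real (cos (q * t))
      + ((q * F (p t)) * of_real (q * cos (q * t)) + (q * (\<i> * deriv F (p t))) * of_real (sin (q * t)))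
      = q\<^sup>2 * (F (p t) * of_real (cos (q * t))) - deriv (deriv F) (p t) * of_real (cos (q * t))"
      by (simp add: complex_eq_iff algebra_simps power2_eq_square)
    ultimately show "((\<lambda>t. \<i> * deriv F (p t) * of_real (cos (q * t)) + q * F (p t) * of_real (sin (q * t))) has_vector_derivative
      q\<^sup>2 * (F (p t) * of_real (cos (q * t))) - deriv (deriv F) (p t) * of_real (cos (q * t))) (at t within {-\<beta>..\<beta>})"
      by (simp only:)
  qed (use \<beta> in simp)
  then have total: "((\<lambda>t. q\<^sup>2 * (F (p t) * of_real (cos (q * t))) - deriv (deriv F) (p t) * of_real (cos (q * t))) has_integral
     q * F (p \<beta>) + q * F (p (-\<beta>))) {-\<beta>..\<beta>}"
    by (simp add: \<beta>(3))
  have int: "(\<lambda>t. G (p t) * of_real (cos (q * t))) integrable_on {-\<beta>..\<beta>}" if "G holomorphic_on strip" for G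
  proof (intro integrable_continuous_real continuous_intros)
    show "continuous_on {-\<beta>..\<beta>} (\<lambda>t. G (p t))"
      unfolding continuous_on_eq_continuous_within using dG[OF that]
      by (blast intro: has_vector_derivative_continuous)
  qed
  have "q * F (p \<beta>) + q * F (p (-\<beta>)) =
     q\<^sup>2 * integral {-\<beta>..\<beta>} (\<lambda>t. F (p t) * of_real (cos (q * t))) - integral {-\<beta>..\<beta>} (\<lambda>t. deriv (deriv F) (p t) * of_real (cos (q * t)))"
    by (rule has_integral_unique[OF total has_integral_diff[OF
          has_integral_mult_right[OF integrable_integral[OF int[OF F]]] integrable_integral[OF int[OF ddF]]]])
  then have "cos_mean q (deriv (deriv F)) (of_real x) = q\<^sup>2 * cos_mean q F (of_real x) - q * (F (p \<beta>) + F (p (-\<beta>)))"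
    by (simp add: cos_mean_def p_def \<beta>_def algebra_simps)
  moreover have "p \<beta> = Complex x (pi / 2 + pi / (2 * q))" "p (-\<beta>) = Complex x (pi / 2 - pi / (2 * q))"
    by (simp_all add: p_def \<beta>_def complex_eq_iff)
  ultimately show ?thesis by (simp flip: of_real_power)
qed

text \<open>
  The differential form of Carleman's formula. The boundary values enter with a negative sign, so a
  lower bound for them is an upper bound for \<open>m'' - q\<^sup>2 m\<close>.
\<close>

lemma carleman_estimate:
  assumes F: "F holomorphic_on strip" and q: "1 < q" "q < p" and D: "0 \<le> D" and "a \<le> b"
    and upper: "\<And>t. t \<in> {a..b} \<Longrightarrow> - (D * exp (p * t)) \<le> Re (F (Complex t (pi / 2 + pi / (2 * q))))"
    and lower: "\<And>t. t \<in> {a..b} \<Longrightarrow> - (D * exp (p * t)) \<le> Re (F (Complex t (pi / 2 - pi / (2 * q))))"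
  shows "Re (cos_mean q F (of_real b)) \<le>
    (\<bar>Re (cos_mean q F (of_real a))\<bar> + \<bar>Re (cos_mean q (deriv F) (of_real a)) + q * Re (cos_mean q F (of_real a))\<bar> / (2 * q))
      * exp (q * (b - a)) + 2 * q * D / (p\<^sup>2 - q\<^sup>2) * exp (p * b)"
proof (rule second_order_comparison[where m'' = "\<lambda>t. Re (cos_mean q (deriv (deriv F)) (of_real t))"])
  fix t assume t: "t \<in> {a..b}"
  have "- (q * (Re (F (Complex t (pi / 2 + pi / (2 * q)))) + Re (F (Complex t (pi / 2 - pi / (2 * q))))))
      \<le> q * (2 * (D * exp (p * t)))"
    unfolding mult_minus_right[symmetric] using upper[OF t] lower[OF t] q by (intro mult_left_mono) auto
  then show "Re (cos_mean q (deriv (deriv F)) (of_real t)) - q\<^sup>2 * Re (cos_mean q F (of_real t)) \<le> 2 * q * D * exp (p * t)"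
    using cos_mean_second_derivative[OF F q(1), of t] by simp
qed (use q D \<open>a \<le> b\<close> in \<open>auto intro: cos_mean_derivative[OF F q(1)]
      cos_mean_derivative[OF holomorphic_deriv[OF F open_strip] q(1)]\<close>)

lemma Re_cos_mean:
  assumes F: "F holomorphic_on strip" and q: "1 < q"
  shows "((\<lambda>t. Re (F (Complex x (pi / 2 + t))) * cos (q * t)) has_integral Re (cos_mean q F (of_real x)))
    {- (pi / (2 * q)) .. pi / (2 * q)}"
proof -
  have x: "of_real x + \<i> * of_real (pi / 2 + t) = Complex x (pi / 2 + t)" for t
    by (simp add: complex_eq_iff)
  have "Im (complex_of_real x) = 0" "0 < pi / 2 - pi / (2 * q)" using q by (auto simp: field_simps)
  then have "continuous_on {- (pi / (2 * q)) .. pi / (2 * q)}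
      (\<lambda>t. (\<lambda>(\<zeta>, t). F (\<zeta> + \<i> * of_real (pi / 2 + t)) * of_real (cos (q * t))) (of_real x, t))"
    by (intro continuous_on_compose2[OF continuous_on_around_middle[OF F q]] continuous_on_Pair
        continuous_on_const continuous_on_id) auto
  then have "((\<lambda>t. F (of_real x + \<i> * of_real (pi / 2 + t)) * of_real (cos (q * t))) has_integral cos_mean q F (of_real x))
      {- (pi / (2 * q)) .. pi / (2 * q)}"
    unfolding cos_mean_def by (intro integrable_integral integrable_continuous_real) simp
  then have "((\<lambda>t. Re (F (of_real x + \<i> * of_real (pi / 2 + t)) * of_real (cos (q * t)))) has_integral
      Re (cos_mean q F (of_real x))) {- (pi / (2 * q)) .. pi / (2 * q)}"
    by (rule has_integral_Re)
  then show ?thesis unfolding x by simp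
qed

section \<open>Bounds in the strip\<close>

lemma sin_ge_half: "x / 2 \<le> sin x" if x: "0 \<le> x" "x \<le> pi / 2" for x :: real
proof (cases "x \<le> pi / 3")
  case True
  have "sin 0 - 0 / 2 \<le> sin x - x / 2"
  proof (rule DERIV_nonneg_imp_nondecreasing[OF x(1)])
    fix y assume y: "0 \<le> y" "y \<le> x"
    have "cos (pi / 3) \<le> cos y" using y True x by (intro cos_monotone_0_pi_le) auto
    then show "\<exists>d. ((\<lambda>x. sin x - x / 2) has_real_derivative d) (at y) \<and> 0 \<le> d"
      by (intro exI[of _ "cos y - 1 / 2"]) (auto intro!: derivative_eq_intros simp: cos_60)
  qed
  then show ?thesis by simp
next
  case False
  have "x / 2 \<le> pi / 4" using x by simp
  also have "pi / 4 \<le> 8 / 10" using pi_less_4 pi_approx by simp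
  also have "8 / 10 \<le> sqrt 3 / 2"
    using real_le_rsqrt[of "16 / 10" 3] by (simp add: power2_eq_square)
  also have "\<dots> = sin (pi / 3)" by (simp add: sin_60)
  also have "\<dots> \<le> sin x" using False x by (intro sin_monotone_2pi_le) auto
  finally show ?thesis .
qed

lemma sin_ge_half_distance: "min y (pi - y) / 2 \<le> sin y" if "0 \<le> y" "y \<le> pi"
proof (cases "y \<le> pi / 2")
  case True
  then show ?thesis using sin_ge_half[of y] that by auto
next
  case False
  then show ?thesis using sin_ge_half[of "pi - y"] that by auto
qed

text \<open>
  The hypothesis of the theorem in logarithmic coordinates. On a segment where \<open>sin y \<ge> \<sigma>\<close> the
  monotone weight is at least \<open>\<Phi> \<sigma>\<close>; replacing the weight by this constant leaves integrals of
  continuous functions only.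
\<close>

definition weighted_negative_mass_le :: "(real \<Rightarrow> real) \<Rightarrow> real \<Rightarrow> (real \<Rightarrow> real) \<Rightarrow> (complex \<Rightarrow> complex) \<Rightarrow> bool" where
  "weighted_negative_mass_le \<Phi> \<xi>0 v F \<longleftrightarrow>
     (\<forall>\<xi>\<ge>\<xi>0. \<forall>a b \<sigma>. 0 < a \<longrightarrow> a \<le> b \<longrightarrow> b < pi \<longrightarrow> 0 < \<sigma> \<longrightarrow> \<sigma> \<le> 1 \<longrightarrow> (\<forall>y\<in>{a..b}. \<sigma> \<le> sin y) \<longrightarrow>
        \<Phi> \<sigma> * integral {a..b} (\<lambda>y. max (- Re (F (Complex \<xi> y))) 0) \<le> v \<xi>)"

text \<open>
  The disc of radius \<open>s / 2\<close> about a point at distance at least \<open>s\<close> from the boundary stays at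
  distance \<open>s / 2\<close> from it, where \<open>sin y \<ge> s / 4\<close>.
\<close>

lemma strip_lower_bound:
  assumes F: "F holomorphic_on strip" and mass: "weighted_negative_mass_le \<Phi> \<xi>0 v F"
    and \<Phi>: "\<And>s. 0 < s \<Longrightarrow> s \<le> 1 \<Longrightarrow> 0 < \<Phi> s"
    and v_nonneg: "\<And>\<xi>. \<xi>0 \<le> \<xi> \<Longrightarrow> 0 \<le> v \<xi>"
    and v_mono: "\<And>s t. \<xi>0 \<le> s \<Longrightarrow> s \<le> t \<Longrightarrow> v s \<le> v t"
    and \<xi>: "\<xi>0 + 1 \<le> \<xi>" and s: "0 < s" "s \<le> y" "s \<le> pi - y"
  shows "- (2 * v (\<xi> + 1) / (s * \<Phi> (s / 4))) \<le> Re (F (Complex \<xi> y))"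
proof -
  have s2: "s \<le> 2" using s pi_less_4 by simp
  have pos: "0 < \<Phi> (s / 4)" using s s2 by (intro \<Phi>) auto
  have in_strip: "s / 2 \<le> Im w \<and> Im w \<le> pi - s / 2" if "w \<in> cball (Complex \<xi> y) (s / 2)" for w
    using that abs_Im_le_cmod[of "w - Complex \<xi> y"] s by (auto simp: dist_norm norm_minus_commute)
  have "pi * (s / 2) * Re (- F (Complex \<xi> y)) \<le> 2 * (v (\<xi> + 1) / \<Phi> (s / 4))"
  proof (rule Re_holomorphic_le_chord_bound[OF _ open_strip convex_strip, where F = "\<lambda>w. - F w"])
    show "(\<lambda>w. - F w) holomorphic_on strip" using F by (rule holomorphic_on_minus)
    show "cball (Complex \<xi> y) (s / 2) \<subseteq> strip" using in_strip s by force
    fix x a b assume x: "\<bar>x - Re (Complex \<xi> y)\<bar> \<le> s / 2"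
      and ab: "Im (Complex \<xi> y) - s / 2 \<le> a" "a \<le> b" "b \<le> Im (Complex \<xi> y) + s / 2"
    have "\<bar>x - \<xi>\<bar> \<le> 1" using x s2 by simp
    then have x': "\<xi>0 \<le> x" "x \<le> \<xi> + 1" using \<xi> by linarith+
    have "\<Phi> (s / 4) * integral {a..b} (\<lambda>y. max (- Re (F (Complex x y))) 0) \<le> v x"
    proof -
      have "s / 4 \<le> sin y'" if "y' \<in> {a..b}" for y'
      proof -
        have "s / 2 \<le> y'" "y' \<le> pi - s / 2" using that ab s by auto
        then show ?thesis using sin_ge_half_distance[of y'] s by (auto simp: min_def split: if_splits)
      qed
      then show ?thesis
        using mass x'(1) ab s s2 unfolding weighted_negative_mass_le_def by (auto simp: field_simps)
    qed
    also have "v x \<le> v (\<xi> + 1)" using x' by (rule v_mono)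
    finally show "integral {a..b} (\<lambda>y. max (Re (- F (Complex x y))) 0) \<le> v (\<xi> + 1) / \<Phi> (s / 4)"
      using pos by (simp add: field_simps)
  qed (use s in simp)
  moreover have "0 \<le> v (\<xi> + 1) / \<Phi> (s / 4)" using pos v_nonneg[of "\<xi> + 1"] \<xi> by simp
  ultimately have "pi * (s * (- Re (F (Complex \<xi> y)))) \<le> 4 * (v (\<xi> + 1) / \<Phi> (s / 4))"
    by (simp add: algebra_simps)
  also have "\<dots> \<le> pi * (2 * (v (\<xi> + 1) / \<Phi> (s / 4)))"
    using \<open>0 \<le> v (\<xi> + 1) / \<Phi> (s / 4)\<close> mult_right_mono[of 4 "pi * 2" "v (\<xi> + 1) / \<Phi> (s / 4)"] pi_gt3
    by (simp add: mult.assoc)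
  finally have "s * (- Re (F (Complex \<xi> y))) \<le> 2 * (v (\<xi> + 1) / \<Phi> (s / 4))"
    by (simp only: mult_le_cancel_left_pos[OF pi_gt_zero])
  then show ?thesis using s pos by (simp add: field_simps)
qed

text \<open>
  The bound \<open>- L\<close> from below turns the upper bound for the cosine mean of \<open>Re F\<close> into one for the mean
  of its positive part. Near the middle of the strip the cosine is at least \<open>1 / 2\<close>, which is what
  \<open>q \<le> 9 / 8\<close> and the length \<open>1\<close> of the segment are for: \<open>9 / 16 \<le> \<pi> / 3\<close>.
\<close>

lemma positive_mass_near_middle:
  assumes F: "F holomorphic_on strip" and q: "1 < q" "q \<le> 9 / 8"
    and "0 \<le> L" and low: "\<And>t. \<bar>t\<bar> \<le> pi / (2 * q) \<Longrightarrow> - L \<le> Re (F (Complex x (pi / 2 + t)))"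
    and mean: "Re (cos_mean q F (of_real x)) \<le> M"
    and ab: "pi / 2 - 1 / 2 \<le> a" "a \<le> b" "b \<le> pi / 2 + 1 / 2"
  shows "integral {a..b} (\<lambda>y. max (Re (F (Complex x y))) 0) \<le> 2 * (M + 4 * L)"
proof -
  define \<beta> where "\<beta> = pi / (2 * q)"
  have \<beta>: "1 / 2 \<le> \<beta>" "\<beta> < pi / 2" "q * \<beta> = pi / 2"
  proof -
    show qb: "q * \<beta> = pi / 2" using q by (simp add: \<beta>_def)
    have "0 < \<beta>" using q by (simp add: \<beta>_def)
    show "\<beta> < pi / 2" using mult_strict_right_mono[OF q(1) \<open>0 < \<beta>\<close>] qb by linarith
    have "q * \<beta> \<le> 9 / 8 * \<beta>" using q \<open>0 < \<beta>\<close> by (intro mult_right_mono) auto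
    then show "1 / 2 \<le> \<beta>" using qb pi_gt3 by linarith
  qed
  let ?U = "\<lambda>t. Re (F (Complex x (pi / 2 + t)))"
  have cont: "continuous_on {-\<beta>..\<beta>} ?U"
    using \<beta> by (intro continuous_on_Re continuous_on_compose2[OF holomorphic_on_imp_continuous_on[OF F]]
        continuous_on_Complex continuous_intros) auto
  have pos_part: "0 \<le> max (?U t) 0 * cos (q * t)" "max (?U t) 0 * cos (q * t) \<le> (?U t) * cos (q * t) + L" 
    if t: "t \<in> {-\<beta>..\<beta>}" for t
  proof -
    have "\<bar>q * t\<bar> \<le> q * \<beta>" using t q by (auto simp: abs_mult abs_le_iff)
    then have c: "0 \<le> cos (q * t)" using \<beta>(3) by (intro cos_ge_zero) (auto simp: abs_le_iff)
    then show "0 \<le> max (?U t) 0 * cos (q * t)" by simp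
    have "max (?U t) 0 \<le> ?U t + L" using low[of t] t \<open>0 \<le> L\<close> by (auto simp: \<beta>_def abs_le_iff max_def)
    then have "max (?U t) 0 * cos (q * t) \<le> (?U t + L) * cos (q * t)" using c by (rule mult_right_mono)
    also have "\<dots> \<le> ?U t * cos (q * t) + L" using \<open>0 \<le> L\<close> by (simp add: distrib_right mult_left_le)
    finally show "max (?U t) 0 * cos (q * t) \<le> (?U t) * cos (q * t) + L" .
  qed
  have int: "((\<lambda>t. ?U t * cos (q * t) + L) has_integral Re (cos_mean q F (of_real x)) + L * (2 * \<beta>)) {-\<beta>..\<beta>}"
    using has_integral_add[OF Re_cos_mean[OF F q(1), of x] has_integral_const_real[of "L" "- (pi / (2 * q))" "pi / (2 * q)"]] \<beta>
    by (simp add: \<beta>_def mult.commute)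
  have ab': "{a - pi / 2 .. b - pi / 2} \<subseteq> {-\<beta>..\<beta>}" using ab \<beta> by auto
  have "integral {a..b} (\<lambda>y. max (Re (F (Complex x y))) 0) = integral {a - pi / 2 .. b - pi / 2} (\<lambda>t. max (?U t) 0)"
  proof -
    have "continuous_on {a - pi / 2 + pi / 2 .. b - pi / 2 + pi / 2} (\<lambda>y. max (Re (F (Complex x y))) 0)"
      using ab pi_gt3 by (intro continuous_on_max continuous_on_const continuous_on_vertical[OF F]) auto
    from integral_shift[OF this] show ?thesis by (simp add: o_def add.commute)
  qed
  also have "\<dots> \<le> integral {a - pi / 2 .. b - pi / 2} (\<lambda>t. 2 * (max (?U t) 0 * cos (q * t)))"
  proof (rule integral_le)
    show "(\<lambda>t. max (?U t) 0) integrable_on {a - pi / 2 .. b - pi / 2}"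
      "(\<lambda>t. 2 * (max (?U t) 0 * cos (q * t))) integrable_on {a - pi / 2 .. b - pi / 2}"
      by (intro integrable_continuous_real continuous_intros continuous_on_subset[OF cont ab'])+
    fix t assume t: "t \<in> {a - pi / 2 .. b - pi / 2}"
    have "\<bar>t\<bar> \<le> 1 / 2" using t ab by (auto simp: abs_le_iff)
    then have "\<bar>q * t\<bar> \<le> 9 / 8 * (1 / 2)" using q unfolding abs_mult by (intro mult_mono) auto
    also have "\<dots> \<le> pi / 3" using pi_gt3 by simp
    finally have "cos (pi / 3) \<le> cos \<bar>q * t\<bar>" by (intro cos_monotone_0_pi_le) auto
    then have "1 / 2 \<le> cos (q * t)" by (simp add: cos_60)
    then have "max (?U t) 0 * (1 / 2) \<le> max (?U t) 0 * cos (q * t)" by (rule mult_left_mono) simp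
    then show "max (?U t) 0 \<le> 2 * (max (?U t) 0 * cos (q * t))" by linarith
  qed
  also have "\<dots> = 2 * integral {a - pi / 2 .. b - pi / 2} (\<lambda>t. max (?U t) 0 * cos (q * t))" by simp
  also have "integral {a - pi / 2 .. b - pi / 2} (\<lambda>t. max (?U t) 0 * cos (q * t)) \<le> integral {-\<beta>..\<beta>} (\<lambda>t. max (?U t) 0 * cos (q * t))"
    using ab' pos_part by (intro integral_subset_le integrable_continuous_real continuous_intros continuous_on_subset[OF cont ab'] cont) auto
  also have "\<dots> \<le> integral {-\<beta>..\<beta>} (\<lambda>t. ?U t * cos (q * t) + L)"
    using int pos_part by (intro integral_le integrable_continuous_real continuous_intros cont) (auto simp: has_integral_iff)
  also have "\<dots> = Re (cos_mean q F (of_real x)) + L * (2 * \<beta>)" using int by (simp add: has_integral_iff)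
  also have "\<dots> \<le> M + 4 * L"
  proof -
    have "L * (2 * \<beta>) \<le> L * 4" using \<beta> pi_less_4 \<open>0 \<le> L\<close> by (intro mult_left_mono) auto
    then show ?thesis using mean by simp
  qed
  finally show ?thesis by simp
qed

lemma exponential_growth_imp_mono:
  fixes v :: "real \<Rightarrow> real"
  assumes "0 \<le> p" "s \<le> t" "0 \<le> v t" "v s \<le> exp (p * (s - t)) * v t"
  shows "v s \<le> v t"
proof -
  have "p * (s - t) \<le> 0" using assms(1,2) by (intro mult_nonneg_nonpos) auto
  then have "exp (p * (s - t)) \<le> 1" by simp
  then have "exp (p * (s - t)) * v t \<le> 1 * v t" using assms(3) by (rule mult_right_mono)
  then show ?thesis using assms(4) by simp
qed

text \<open>
  The constant must not depend on \<open>F\<close>. In the estimate of the cosine mean, \<open>F\<close> enters through its data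
  on the line \<open>Re \<zeta> = \<xi>0 + 1\<close>, multiplied by \<open>exp (q \<xi>)\<close> with \<open>q < p\<close>; since \<open>v\<close> grows at least like
  \<open>exp (p \<xi>)\<close>, this term is eventually dominated by \<open>v\<close>.
\<close>

lemma middle_upper_bound:
  fixes v :: "real \<Rightarrow> real"
  assumes \<Phi>: "\<And>s. 0 < s \<Longrightarrow> s \<le> 1 \<Longrightarrow> 0 < \<Phi> s"
    and p: "1 < p" and v_nonneg: "\<And>\<xi>. \<xi>0 \<le> \<xi> \<Longrightarrow> 0 \<le> v \<xi>" and v_pos: "\<And>\<xi>. \<xi>0 < \<xi> \<Longrightarrow> 0 < v \<xi>"
    and v_growth: "\<And>s t. \<xi>0 \<le> s \<Longrightarrow> s \<le> t \<Longrightarrow> v s \<le> exp (p * (s - t)) * v t"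
  shows "\<exists>C>0. \<forall>F. F holomorphic_on strip \<longrightarrow> weighted_negative_mass_le \<Phi> \<xi>0 v F \<longrightarrow>
       (\<exists>\<xi>1\<ge>\<xi>0. \<forall>b\<ge>\<xi>1. Re (F (Complex b (pi / 2))) \<le> C * v (b + 2))"
proof -
  have v_mono: "v s \<le> v t" if "\<xi>0 \<le> s" "s \<le> t" for s t
    using exponential_growth_imp_mono[OF _ that(2) v_nonneg[OF order_trans[OF that]] v_growth[OF that]] p by simp
  (* q lies strictly between 1 and p, and close enough to 1 for positive_mass_near_middle *)
  define q where "q = (1 + min p (5 / 4)) / 2"
  have q: "1 < q" "q < p" "q \<le> 9 / 8" using p by (auto simp: q_def min_def)
  define \<beta> where "\<beta> = pi / (2 * q)"
  define s where "s = pi / 2 - \<beta>"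
  have \<beta>: "0 < \<beta>" "0 < s" using q by (auto simp: \<beta>_def s_def field_simps)
  have s: "s \<le> 2" using \<beta> pi_less_4 by (simp add: s_def)
  define \<kappa> where "\<kappa> = 2 / (s * \<Phi> (s / 4))"
  have \<kappa>: "0 < \<kappa>" using \<beta> s by (auto simp: \<kappa>_def intro!: \<Phi> mult_pos_pos)
  have pq: "0 < p\<^sup>2 - q\<^sup>2" using q power_strict_mono[of q p 2] by simp
  define c where "c = 2 * q * \<kappa> / (p\<^sup>2 - q\<^sup>2)"
  have c: "0 < c" using q \<kappa> pq by (simp add: c_def)
  define C where "C = 4 * (1 + c + 4 * \<kappa>)"
  show ?thesis
  proof (rule exI[of _ C], intro conjI allI impI)
    show "0 < C" using c \<kappa> by (simp add: C_def)
    fix F assume F: "F holomorphic_on strip" and mass: "weighted_negative_mass_le \<Phi> \<xi>0 v F"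
    have low: "- (\<kappa> * v (t + 1)) \<le> Re (F (Complex t (pi / 2 + \<theta>)))" if "\<xi>0 + 1 \<le> t" "\<bar>\<theta>\<bar> \<le> \<beta>" for t \<theta>
    proof -
      have "- (2 * v (t + 1) / (s * \<Phi> (s / 4))) \<le> Re (F (Complex t (pi / 2 + \<theta>)))"
        using that \<beta> by (intro strip_lower_bound[OF F mass \<Phi> v_nonneg v_mono]) (auto simp: s_def abs_le_iff)
      then show ?thesis by (simp add: \<kappa>_def)
    qed
    define a where "a = \<xi>0 + 1"
    define K where "K = \<bar>Re (cos_mean q F (of_real a))\<bar> +
      \<bar>Re (cos_mean q (deriv F) (of_real a)) + q * Re (cos_mean q F (of_real a))\<bar> / (2 * q)"
    have mean: "Re (cos_mean q F (of_real b)) \<le> K * exp (q * (b - a)) + c * v (b + 1)" if b: "a \<le> b" for b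
    proof -
      (* v (t + 1) \<le> exp (p (t - b)) v (b + 1) for t \<le> b: the right end point fixes the constant *)
      define D where "D = \<kappa> * exp (- p * b) * v (b + 1)"
      have v1: "0 \<le> v (b + 1)" using b by (intro v_nonneg) (simp add: a_def)
      have D: "0 \<le> D" using \<kappa> v1 by (simp add: D_def)
      have low': "- (D * exp (p * t)) \<le> Re (F (Complex t (pi / 2 + \<theta>)))" if t: "t \<in> {a..b}" "\<bar>\<theta>\<bar> \<le> \<beta>" for t \<theta>
      proof -
        have "v (t + 1) \<le> exp (p * (t - b)) * v (b + 1)"
          using v_growth[of "t + 1" "b + 1"] t by (simp add: a_def)
        then have "\<kappa> * v (t + 1) \<le> \<kappa> * (exp (p * (t - b)) * v (b + 1))" using \<kappa> by simp
        also have "\<dots> = D * exp (p * t)" by (simp add: D_def right_diff_distrib exp_diff exp_minus field_simps)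
        finally show ?thesis using low[of t \<theta>] t by (simp add: a_def)
      qed
      have "Re (cos_mean q F (of_real b)) \<le> K * exp (q * (b - a)) + 2 * q * D / (p\<^sup>2 - q\<^sup>2) * exp (p * b)"
        unfolding K_def
      proof (rule carleman_estimate[OF F q(1,2) D b])
        fix t assume t: "t \<in> {a..b}"
        show "- (D * exp (p * t)) \<le> Re (F (Complex t (pi / 2 + pi / (2 * q))))"
          using low'[OF t, of \<beta>] \<beta> by (simp add: \<beta>_def)
        show "- (D * exp (p * t)) \<le> Re (F (Complex t (pi / 2 - pi / (2 * q))))"
          using low'[OF t, of "- \<beta>"] \<beta> by (simp add: \<beta>_def)
      qed
      also have "2 * q * D / (p\<^sup>2 - q\<^sup>2) * exp (p * b) = c * v (b + 1)"
        by (simp add: D_def c_def exp_minus)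
      finally show ?thesis .
    qed
    define b0 where "b0 = a + max 0 (K / v (a + 1) / (p - q))"
    have b0: "K * exp (q * (b - a)) \<le> v (b + 1)" if b: "b0 \<le> b" for b
    proof -
      have va: "0 < v (a + 1)" by (intro v_pos) (simp add: a_def)
      have ab: "a \<le> b" using b by (simp add: b0_def)
      have "K / v (a + 1) / (p - q) \<le> b - a" using b by (simp add: b0_def)
      then have "K / v (a + 1) \<le> (p - q) * (b - a)" 
      using q pos_divide_le_eq[of "p - q" "K / v (a + 1)" "b - a"] by (metis diff_gt_0_iff_gt mult.commute)
      then have "K / v (a + 1) \<le> exp ((p - q) * (b - a))"
        using exp_ge_add_one_self[of "(p - q) * (b - a)"] by linarith
      then have "K \<le> exp ((p - q) * (b - a)) * v (a + 1)" using va by (simp add: divide_le_eq)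
      then have "K * exp (q * (b - a)) \<le> exp ((p - q) * (b - a)) * v (a + 1) * exp (q * (b - a))"
        by (intro mult_right_mono) auto
      also have "\<dots> = exp (p * (b - a)) * v (a + 1)"
      proof -
        have "exp ((p - q) * (b - a)) * exp (q * (b - a)) = exp (p * (b - a))"
          by (simp add: exp_add[symmetric] algebra_simps)
        then show ?thesis by (simp add: mult_ac)
      qed
      also have "\<dots> \<le> v (b + 1)"
      proof -
        have "v (a + 1) \<le> exp (p * (a - b)) * v (b + 1)"
          using v_growth[of "a + 1" "b + 1"] ab by (simp add: a_def algebra_simps)
        then have "exp (p * (b - a)) * v (a + 1) \<le> exp (p * (b - a)) * (exp (p * (a - b)) * v (b + 1))" by simp
        also have "\<dots> = v (b + 1)"
        proof -
          have "exp (p * (b - a)) * exp (p * (a - b)) = 1"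
            by (simp add: exp_add[symmetric] algebra_simps)
          then show ?thesis by (simp only: mult.assoc[symmetric] mult_1)
        qed
        finally show ?thesis .
      qed
      finally show ?thesis .
    qed
    define b1 where "b1 = max a b0"
    have mass_mid: "integral {l..r} (\<lambda>y. max (Re (F (Complex x y))) 0) \<le> C / 2 * v (x + 1)"
      if x: "b1 \<le> x" and lr: "pi / 2 - 1 / 2 \<le> l" "l \<le> r" "r \<le> pi / 2 + 1 / 2" for x l r
    proof -
      have x': "a \<le> x" "b0 \<le> x" using x by (auto simp: b1_def)
      have "Re (cos_mean q F (of_real x)) \<le> (1 + c) * v (x + 1)"
        using mean[OF x'(1)] b0[OF x'(2)] by (simp add: distrib_right)
      moreover have "- (\<kappa> * v (x + 1)) \<le> Re (F (Complex x (pi / 2 + t)))" if "\<bar>t\<bar> \<le> pi / (2 * q)" for t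
        using low[of x t] x' that by (simp add: a_def \<beta>_def)
      moreover have "0 \<le> \<kappa> * v (x + 1)" using \<kappa> v_nonneg[of "x + 1"] x' by (simp add: a_def)
      ultimately have "integral {l..r} (\<lambda>y. max (Re (F (Complex x y))) 0) \<le> 2 * ((1 + c) * v (x + 1) + 4 * (\<kappa> * v (x + 1)))"
        using lr by (intro positive_mass_near_middle[OF F q(1,3)]) auto
      then show ?thesis by (simp add: C_def algebra_simps)
    qed
    have "Re (F (Complex b (pi / 2))) \<le> C * v (b + 2)" if b: "b1 + 1 \<le> b" for b
    proof -
      have "pi * (1 / 2) * Re (F (Complex b (pi / 2))) \<le> 2 * (C / 2 * v (b + 2))"
      proof (rule Re_holomorphic_le_chord_bound[OF F open_strip convex_strip])
        show "cball (Complex b (pi / 2)) (1 / 2) \<subseteq> strip"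
        proof
          fix w assume "w \<in> cball (Complex b (pi / 2)) (1 / 2)"
          then have "\<bar>Im w - pi / 2\<bar> \<le> 1 / 2"
            using abs_Im_le_cmod[of "w - Complex b (pi / 2)"] by (simp add: dist_norm norm_minus_commute)
          then have "0 < Im w" "Im w < pi" using pi_gt3 by linarith+
          then show "w \<in> strip" by simp
        qed
        fix x l r assume x: "\<bar>x - Re (Complex b (pi / 2))\<bar> \<le> 1 / 2"
          and lr: "Im (Complex b (pi / 2)) - 1 / 2 \<le> l" "l \<le> r" "r \<le> Im (Complex b (pi / 2)) + 1 / 2"
        have "\<bar>x - b\<bar> \<le> 1 / 2" using x by simp
        then have x': "b1 \<le> x" "x \<le> b + 1" using b by linarith+
        then have "\<xi>0 \<le> x + 1" by (simp add: b1_def a_def)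
        have "integral {l..r} (\<lambda>y. max (Re (F (Complex x y))) 0) \<le> C / 2 * v (x + 1)"
          using lr by (intro mass_mid x') auto
        also have "\<dots> \<le> C / 2 * v (b + 2)"
          using \<open>0 < C\<close> x' \<open>\<xi>0 \<le> x + 1\<close> by (intro mult_left_mono v_mono) auto
        finally show "integral {l..r} (\<lambda>y. max (Re (F (Complex x y))) 0) \<le> C / 2 * v (b + 2)" .
      qed simp
      then have "pi / 2 * Re (F (Complex b (pi / 2))) \<le> C * v (b + 2)" by simp
      moreover have "0 \<le> C * v (b + 2)"
        using \<open>0 < C\<close> b v_nonneg[of "b + 2"] by (simp add: b1_def a_def)
      moreover have "Re (F (Complex b (pi / 2))) \<le> pi / 2 * Re (F (Complex b (pi / 2)))"
        if "0 \<le> Re (F (Complex b (pi / 2)))"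
        using mult_right_mono[of 1 "pi / 2", OF _ that] pi_gt3 by simp
      ultimately show ?thesis by linarith
    qed
    moreover have "\<xi>0 \<le> b1 + 1" by (simp add: b1_def a_def)
    ultimately show "\<exists>\<xi>1\<ge>\<xi>0. \<forall>b\<ge>\<xi>1. Re (F (Complex b (pi / 2))) \<le> C * v (b + 2)" by blast
  qed
qed

text \<open>
  A point at distance at least \<open>s = sin y\<close> from the boundary is the centre of a disc of radius \<open>s / 2\<close>
  inside the disc about the middle point \<open>\<xi> + \<i> \<pi>/2\<close> that stays \<open>s / 2\<close> away from the boundary. On
  the latter \<open>Re F + L \<ge> 0\<close>, and comparing the areas costs a factor of order \<open>s\<^sup>-\<^sup>2\<close>, while \<open>L\<close>
  itself costs \<open>1 / (s \<Phi> (s/8))\<close>. The discs have radius less than \<open>2\<close>, which explains the shift of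
  the argument of \<open>v\<close>.
\<close>

lemma strip_upper_bound:
  fixes v :: "real \<Rightarrow> real"
  assumes \<Phi>: "\<And>s. 0 < s \<Longrightarrow> s \<le> 1 \<Longrightarrow> 0 < \<Phi> s" and \<Phi>_mono: "mono_on {0..1} \<Phi>"
    and p: "1 < p" and v_nonneg: "\<And>\<xi>. \<xi>0 \<le> \<xi> \<Longrightarrow> 0 \<le> v \<xi>" and v_pos: "\<And>\<xi>. \<xi>0 < \<xi> \<Longrightarrow> 0 < v \<xi>"
    and v_growth: "\<And>s t. \<xi>0 \<le> s \<Longrightarrow> s \<le> t \<Longrightarrow> v s \<le> exp (p * (s - t)) * v t"
  shows "\<exists>C>0. \<forall>F. F holomorphic_on strip \<longrightarrow> weighted_negative_mass_le \<Phi> \<xi>0 v F \<longrightarrow>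
       (\<exists>\<xi>1. \<forall>\<xi>\<ge>\<xi>1. \<forall>y. 0 < y \<longrightarrow> y < pi \<longrightarrow> Re (F (Complex \<xi> y)) * (sin y ^ 3 * \<Phi> (sin y / 8)) \<le> C * v (\<xi> + 4))"
proof -
  have v_mono: "v s \<le> v t" if "\<xi>0 \<le> s" "s \<le> t" for s t
    using exponential_growth_imp_mono[OF _ that(2) v_nonneg[OF order_trans[OF that]] v_growth[OF that]] p by simp
  have "\<exists>C>0. \<forall>F. F holomorphic_on strip \<longrightarrow> weighted_negative_mass_le \<Phi> \<xi>0 v F \<longrightarrow>
       (\<exists>\<xi>1\<ge>\<xi>0. \<forall>b\<ge>\<xi>1. Re (F (Complex b (pi / 2))) \<le> C * v (b + 2))"
    by (rule middle_upper_bound[where p = p]) (fact assms)+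
  then obtain C1 where "0 < C1"
    and mid: "\<forall>F. F holomorphic_on strip \<longrightarrow> weighted_negative_mass_le \<Phi> \<xi>0 v F \<longrightarrow>
       (\<exists>\<xi>1\<ge>\<xi>0. \<forall>b\<ge>\<xi>1. Re (F (Complex b (pi / 2))) \<le> C1 * v (b + 2))"
    by (elim exE conjE)
  define C where "C = 16 * (C1 * \<Phi> 1 + 4)"
  show ?thesis
  proof (rule exI[of _ C], intro conjI allI impI)
    have \<Phi>1: "0 < \<Phi> 1" by (rule \<Phi>) auto
    then show "0 < C" using \<open>0 < C1\<close> by (simp add: C_def add_pos_pos)
    fix F assume F: "F holomorphic_on strip" and mass: "weighted_negative_mass_le \<Phi> \<xi>0 v F"
    obtain b1 where "\<xi>0 \<le> b1" and b1: "\<And>b. b1 \<le> b \<Longrightarrow> Re (F (Complex b (pi / 2))) \<le> C1 * v (b + 2)"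
      using mid[rule_format, OF F mass] by auto
    have "Re (F (Complex b y)) * (sin y ^ 3 * \<Phi> (sin y / 8)) \<le> C * v (b + 4)"
      if b: "b1 + 3 \<le> b" and y: "0 < y" "y < pi" for b y
    proof -
      define s where "s = sin y"
      have s: "0 < s" "s \<le> 1" "s \<le> y" "s \<le> pi - y"
        using y sin_gt_zero[of y] sin_x_le_x[of y] sin_x_le_x[of "pi - y"] by (auto simp: s_def)
      have \<Phi>s: "0 < \<Phi> (s / 8)" "\<Phi> (s / 8) \<le> \<Phi> 1"
        using s \<Phi>_mono by (auto intro!: \<Phi> simp: mono_on_def)
      have v4: "0 \<le> v (b + 4)" using b \<open>\<xi>0 \<le> b1\<close> by (intro v_nonneg) simp
      define L where "L = 4 * v (b + 4) / (s * \<Phi> (s / 8))"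
      have L: "0 \<le> L" using s \<Phi>s v4 by (simp add: L_def)
      have disc: "\<bar>Re w - b\<bar> \<le> 2 \<and> s / 2 \<le> Im w \<and> Im w \<le> pi - s / 2"
        if w: "w \<in> cball (Complex b (pi / 2)) (pi / 2 - s / 2)" for w
      proof -
        have "cmod (w - Complex b (pi / 2)) \<le> pi / 2 - s / 2"
          using w by (simp add: dist_norm norm_minus_commute)
        then have "\<bar>Re w - b\<bar> \<le> pi / 2 - s / 2" "\<bar>Im w - pi / 2\<bar> \<le> pi / 2 - s / 2"
          using abs_Re_le_cmod[of "w - Complex b (pi / 2)"] abs_Im_le_cmod[of "w - Complex b (pi / 2)"] by auto
        then show ?thesis using s pi_less_4 by (auto simp: abs_le_iff)
      qed
      have "(s / 2)\<^sup>2 * Re (F (Complex b y) + of_real L) \<le> (pi / 2 - s / 2)\<^sup>2 * Re (F (Complex b (pi / 2)) + of_real L)"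
      proof (rule nested_disc_harnack[OF _ open_strip convex_strip, where F = "\<lambda>w. F w + of_real L"])
        show "(\<lambda>w. F w + of_real L) holomorphic_on strip"
          by (intro holomorphic_on_add F holomorphic_on_const)
        show "cball (Complex b (pi / 2)) (pi / 2 - s / 2) \<subseteq> strip"
        proof
          fix w assume "w \<in> cball (Complex b (pi / 2)) (pi / 2 - s / 2)"
          from disc[OF this] show "w \<in> strip" using s by simp
        qed
        have "dist (Complex b y) (Complex b (pi / 2)) = \<bar>y - pi / 2\<bar>"
          by (simp add: dist_norm cmod_def)
        then show "dist (Complex b y) (Complex b (pi / 2)) + s / 2 \<le> pi / 2 - s / 2" using s by linarith
        fix w assume "w \<in> cball (Complex b (pi / 2)) (pi / 2 - s / 2)"
        from disc[OF this] have w: "b - 2 \<le> Re w" "Re w \<le> b + 2" "s / 2 \<le> Im w" "s / 2 \<le> pi - Im w"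
          by (auto simp: abs_le_iff)
        have "- (2 * v (Re w + 1) / (s / 2 * \<Phi> (s / 2 / 4))) \<le> Re (F (Complex (Re w) (Im w)))"
          using w s b \<open>\<xi>0 \<le> b1\<close> by (intro strip_lower_bound[OF F mass \<Phi> v_nonneg v_mono]) auto
        moreover have "2 * v (Re w + 1) / (s / 2 * \<Phi> (s / 2 / 4)) \<le> L"
        proof -
          have "v (Re w + 1) \<le> v (b + 4)" using w b \<open>\<xi>0 \<le> b1\<close> by (intro v_mono) auto
          then have "4 * v (Re w + 1) / (s * \<Phi> (s / 8)) \<le> L"
            unfolding L_def using s \<Phi>s by (intro divide_right_mono) auto
          then show ?thesis by simp
        qed
        ultimately show "0 \<le> Re (F w + of_real L)" by simp
      qed (use s in auto)
      also have "\<dots> \<le> 4 * (C1 * v (b + 4) + L)"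
      proof -
        have "Re (F (Complex b (pi / 2))) \<le> C1 * v (b + 2)" using b by (intro b1) simp
        also have "\<dots> \<le> C1 * v (b + 4)" using b \<open>\<xi>0 \<le> b1\<close> \<open>0 < C1\<close> by (intro mult_left_mono v_mono) auto
        finally have 1: "Re (F (Complex b (pi / 2)) + of_real L) \<le> C1 * v (b + 4) + L" by simp
        have 2: "(pi / 2 - s / 2)\<^sup>2 \<le> 2\<^sup>2" using s pi_less_4 pi_gt3 by (intro power_mono) auto
        have "(pi / 2 - s / 2)\<^sup>2 * Re (F (Complex b (pi / 2)) + of_real L) \<le> (pi / 2 - s / 2)\<^sup>2 * (C1 * v (b + 4) + L)"
          using 1 by (intro mult_left_mono) auto
        also have "\<dots> \<le> 2\<^sup>2 * (C1 * v (b + 4) + L)"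
          using 2 L v4 \<open>0 < C1\<close> by (intro mult_right_mono) auto
        finally show ?thesis by simp
      qed
      finally have "s\<^sup>2 * (Re (F (Complex b y)) + L) \<le> 16 * (C1 * v (b + 4) + L)"
        by (simp add: power_divide)
      moreover have "0 \<le> s\<^sup>2 * L" using L by simp
      ultimately have "s\<^sup>2 * Re (F (Complex b y)) \<le> 16 * (C1 * v (b + 4) + L)" by (simp add: distrib_left)
      then have "(s * \<Phi> (s / 8)) * (s\<^sup>2 * Re (F (Complex b y))) \<le> (s * \<Phi> (s / 8)) * (16 * (C1 * v (b + 4) + L))"
        using s \<Phi>s by (intro mult_left_mono) auto
      also have "\<dots> = 16 * (C1 * (s * \<Phi> (s / 8)) + 4) * v (b + 4)"
        using s \<Phi>s by (simp add: L_def field_simps)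
      also have "\<dots> \<le> C * v (b + 4)"
      proof -
        have "s * \<Phi> (s / 8) \<le> 1 * \<Phi> 1" using s \<Phi>s by (intro mult_mono) auto
        then show ?thesis unfolding C_def using \<open>0 < C1\<close> v4 by (intro mult_right_mono) auto
      qed
      finally show ?thesis by (simp add: s_def power2_eq_square power3_eq_cube mult_ac)
    qed
    then show "\<exists>\<xi>1. \<forall>\<xi>\<ge>\<xi>1. \<forall>y. 0 < y \<longrightarrow> y < pi \<longrightarrow> Re (F (Complex \<xi> y)) * (sin y ^ 3 * \<Phi> (sin y / 8)) \<le> C * v (\<xi> + 4)"
      by blast
  qed
qed

section \<open>From the strip to the plane\<close>

lemma exp_Complex: "exp (Complex \<xi> y) = rcis (exp \<xi>) y"
  by (simp add: complex_eq_iff Re_exp Im_exp)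

text \<open>
  Both half-planes are pulled back to the same strip, the lower one through complex conjugation.
\<close>

lemma half_plane_traces:
  assumes u: "eharmonic_on u (UNIV - \<real>)"
  obtains F1 F2 where "F1 holomorphic_on strip" "F2 holomorphic_on strip"
    "\<And>\<xi> y. 0 < y \<Longrightarrow> y < pi \<Longrightarrow> u (rcis (exp \<xi>) y) = ereal (Re (F1 (Complex \<xi> y)))"
    "\<And>\<xi> y. 0 < y \<Longrightarrow> y < pi \<Longrightarrow> u (rcis (exp \<xi>) (- y)) = ereal (Re (F2 (Complex \<xi> y)))"
proof -
  let ?H = "{z. 0 < Im z}" and ?L = "{z. Im z < 0}"
  obtain h where h: "harmonic_on h (UNIV - \<real>)" and uh: "\<And>z. z \<in> UNIV - \<real> \<Longrightarrow> u z = ereal (h z)"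
    using u unfolding eharmonic_on_def by auto
  have sub: "?H \<subseteq> UNIV - \<real>" "?L \<subseteq> UNIV - \<real>" by (auto simp: complex_is_Real_iff)
  obtain f1 where f1: "f1 holomorphic_on ?H" "\<And>z. z \<in> ?H \<Longrightarrow> Re (f1 z) = h z"
    using harmonic_on_convex_imp_Re_holomorphic[OF h open_halfspace_Im_gt convex_halfspace_Im_gt sub(1)] by blast
  obtain f2 where f2: "f2 holomorphic_on ?L" "\<And>z. z \<in> ?L \<Longrightarrow> Re (f2 z) = h z"
    using harmonic_on_convex_imp_Re_holomorphic[OF h open_halfspace_Im_lt convex_halfspace_Im_lt sub(2)] by blast
  have exp_strip: "exp ` strip \<subseteq> ?H" by (auto simp: Im_exp sin_gt_zero)
  have cnj: "cnj ` ?H = ?L"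
  proof
    show "?L \<subseteq> cnj ` ?H"
    proof
      fix z assume "z \<in> ?L"
      then show "z \<in> cnj ` ?H" by (intro image_eqI[of _ _ "cnj z"]) auto
    qed
  qed auto
  have f2': "(cnj \<circ> f2 \<circ> cnj) holomorphic_on ?H"
    using f2(1) cnj by (intro holomorphic_on_compose_cnj_cnj open_halfspace_Im_gt) auto
  show ?thesis
  proof
    show "(f1 \<circ> exp) holomorphic_on strip"
      by (rule holomorphic_on_compose_gen[OF holomorphic_on_exp f1(1) exp_strip])
    show "((cnj \<circ> f2 \<circ> cnj) \<circ> exp) holomorphic_on strip"
      by (rule holomorphic_on_compose_gen[OF holomorphic_on_exp f2' exp_strip])
    fix \<xi> y :: real assume y: "0 < y" "y < pi"
    have up: "rcis (exp \<xi>) y \<in> ?H" using y by (simp add: sin_gt_zero)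
    have "u (rcis (exp \<xi>) y) = ereal (h (rcis (exp \<xi>) y))" by (intro uh subsetD[OF sub(1) up])
    then show "u (rcis (exp \<xi>) y) = ereal (Re ((f1 \<circ> exp) (Complex \<xi> y)))"
      using f1(2)[OF up] by (simp add: exp_Complex)
    have down: "rcis (exp \<xi>) (- y) \<in> ?L" using y by (simp add: sin_gt_zero)
    have "u (rcis (exp \<xi>) (- y)) = ereal (h (rcis (exp \<xi>) (- y)))" by (intro uh subsetD[OF sub(2) down])
    moreover have "cnj (rcis (exp \<xi>) y) = rcis (exp \<xi>) (- y)" by (simp add: complex_eq_iff)
    ultimately show "u (rcis (exp \<xi>) (- y)) = ereal (Re (((cnj \<circ> f2 \<circ> cnj) \<circ> exp) (Complex \<xi> y)))"
      using f2(2)[OF down] by (simp add: exp_Complex)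
  qed
qed

lemma integral_le_nn_integral:
  fixes g :: "real \<Rightarrow> real"
  assumes cont: "continuous_on {a..b} g" and nonneg: "\<And>\<theta>. \<theta> \<in> {a..b} \<Longrightarrow> 0 \<le> g \<theta>" and "0 \<le> c"
    and sub: "{a..b} \<subseteq> {l..r}" and le: "\<And>\<theta>. \<theta> \<in> {a..b} \<Longrightarrow> ennreal (g \<theta>) * ennreal c \<le> K \<theta>"
  shows "ennreal (c * integral {a..b} g) \<le> (\<integral>\<^sup>+ \<theta>\<in>{l..r}. K \<theta> \<partial>lborel)"
proof -
  have "((\<lambda>\<theta>. c * g \<theta>) has_integral c * integral {a..b} g) {a..b}"
    by (intro has_integral_mult_right integrable_integral integrable_continuous_real cont)
  then have "(\<integral>\<^sup>+ \<theta>. ennreal (indicator {a..b} \<theta> * (c * g \<theta>)) \<partial>lborel) = ennreal (c * integral {a..b} g)"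
    using nonneg \<open>0 \<le> c\<close> by (intro nn_integral_has_integral_lebesgue) auto
  moreover have "(\<integral>\<^sup>+ \<theta>. ennreal (indicator {a..b} \<theta> * (c * g \<theta>)) \<partial>lborel) \<le> (\<integral>\<^sup>+ \<theta>\<in>{l..r}. K \<theta> \<partial>lborel)"
  proof (rule nn_integral_mono)
    fix \<theta> show "ennreal (indicator {a..b} \<theta> * (c * g \<theta>)) \<le> K \<theta> * indicator {l..r} \<theta>"
    proof (cases "\<theta> \<in> {a..b}")
      case True
      moreover have "\<theta> \<in> {l..r}" using True sub by blast
      moreover have "ennreal (c * g \<theta>) = ennreal (g \<theta>) * ennreal c"
        using nonneg[OF True] \<open>0 \<le> c\<close> by (simp add: ennreal_mult mult.commute)
      ultimately show ?thesis using le[OF True] by simp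
    qed simp
  qed
  ultimately show ?thesis by simp
qed

text \<open>
  The sign \<open>\<epsilon>\<close> selects the half-plane, as in \<open>half_plane_traces\<close>.
\<close>

lemma weighted_negative_mass_le_trace:
  assumes F: "F holomorphic_on strip" and \<epsilon>: "\<epsilon> = 1 \<or> \<epsilon> = (- 1 :: real)"
    and trace: "\<And>\<xi> y. 0 < y \<Longrightarrow> y < pi \<Longrightarrow> u (rcis (exp \<xi>) (\<epsilon> * y)) = ereal (Re (F (Complex \<xi> y)))"
    and \<Phi>: "\<And>s. 0 < s \<Longrightarrow> s \<le> 1 \<Longrightarrow> 0 < \<Phi> s" and mono: "mono_on {0..1} \<Phi>" and "0 < r0"
    and mass: "\<And>r. r0 \<le> r \<Longrightarrow> enn2ereal (\<integral>\<^sup>+ \<theta>\<in>{-pi..pi}.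
        e2ennreal (max (- u (rcis r \<theta>)) 0) * ennreal (\<Phi> \<bar>sin \<theta>\<bar>) \<partial>lborel) \<le> ereal (V r)"
  shows "weighted_negative_mass_le \<Phi> (ln r0) (\<lambda>\<xi>. V (exp \<xi>)) F"
  unfolding weighted_negative_mass_le_def
proof (intro allI impI)
  fix \<xi> a b \<sigma> assume \<xi>: "ln r0 \<le> \<xi>" and ab: "0 < a" "a \<le> b" "b < pi" and \<sigma>: "0 < \<sigma>" "\<sigma> \<le> 1"
    and sin: "\<forall>y\<in>{a..b}. \<sigma> \<le> sin y"
  let ?g = "\<lambda>y. max (- Re (F (Complex \<xi> y))) 0"
  let ?K = "\<lambda>\<theta>. e2ennreal (max (- u (rcis (exp \<xi>) \<theta>)) 0) * ennreal (\<Phi> \<bar>sin \<theta>\<bar>)"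
  have "exp (ln r0) \<le> exp \<xi>" using \<xi> by (simp only: exp_le_cancel_iff)
  then have r: "r0 \<le> exp \<xi>" using \<open>0 < r0\<close> by simp
  have \<Phi>0: "0 \<le> \<Phi> \<sigma>" using \<Phi>[OF \<sigma>] by simp
  have cont: "continuous_on {a..b} ?g"
    using ab by (intro continuous_on_max continuous_on_minus continuous_on_const continuous_on_vertical[OF F]) auto
  have K: "ennreal (?g y) * ennreal (\<Phi> \<sigma>) \<le> ?K (\<epsilon> * y)" if y: "y \<in> {a..b}" for y
  proof -
    have "max (- u (rcis (exp \<xi>) (\<epsilon> * y))) 0 = ereal (?g y)"
      using trace[of y \<xi>] y ab by (simp add: max_def)
    then have "e2ennreal (max (- u (rcis (exp \<xi>) (\<epsilon> * y))) 0) = ennreal (?g y)" by (simp only: e2ennreal_ereal)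
    moreover have "\<bar>sin (\<epsilon> * y)\<bar> = sin y" using \<epsilon> y ab sin_gt_zero[of y] by auto
    moreover have "\<Phi> \<sigma> \<le> \<Phi> (sin y)"
    proof -
      have "\<sigma> \<le> sin y" using sin y by blast
      then show ?thesis using mono_onD[OF mono, of \<sigma> "sin y"] \<sigma> sin_le_one[of y] by simp
    qed
    ultimately show ?thesis by (simp add: mult_left_mono ennreal_leI)
  qed
  have "ennreal (\<Phi> \<sigma> * integral {a..b} ?g) \<le> (\<integral>\<^sup>+ \<theta>\<in>{-pi..pi}. ?K \<theta> \<partial>lborel)"
    using \<epsilon>
  proof
    assume "\<epsilon> = 1"
    then show ?thesis using K ab \<Phi>0 by (intro integral_le_nn_integral cont) auto
  next
    assume \<epsilon>1: "\<epsilon> = - 1"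
    have "ennreal (\<Phi> \<sigma> * integral {-b..-a} (\<lambda>y. ?g (- y))) \<le> (\<integral>\<^sup>+ \<theta>\<in>{-pi..pi}. ?K \<theta> \<partial>lborel)"
    proof (rule integral_le_nn_integral)
      show "continuous_on {-b..-a} (\<lambda>y. ?g (- y))"
        by (rule continuous_on_compose2[OF cont]) (auto intro!: continuous_intros)
      show "ennreal (?g (- \<theta>)) * ennreal (\<Phi> \<sigma>) \<le> ?K \<theta>" if "\<theta> \<in> {-b..-a}" for \<theta>
        using K[of "- \<theta>"] that \<epsilon>1 by simp
    qed (use ab \<Phi>0 in auto)
    then show ?thesis
      using Henstock_Kurzweil_Integration.integral_reflect_real[where a = a and b = b and f = ?g] by simp
  qed
  then have "enn2ereal (ennreal (\<Phi> \<sigma> * integral {a..b} ?g)) \<le> ereal (V (exp \<xi>))"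
    using mass[OF r] by (auto simp: less_eq_ennreal.rep_eq intro: order_trans)
  moreover have "0 \<le> \<Phi> \<sigma> * integral {a..b} ?g"
    using \<Phi>0 by (intro mult_nonneg_nonneg integral_nonneg integrable_continuous_real cont) auto
  ultimately show "\<Phi> \<sigma> * integral {a..b} ?g \<le> V (exp \<xi>)" by simp
qed

text \<open>
  The bound of \<open>strip_upper_bound\<close> for both half-planes, back in the coordinate \<open>z\<close>:
  \<open>sin y\<close> becomes \<open>\<bar>Im z\<bar> / \<bar>z\<bar>\<close>.
\<close>

lemma off_axis_bound:
  assumes \<Phi>: "\<And>s. 0 < s \<Longrightarrow> s \<le> 1 \<Longrightarrow> 0 < \<Phi> s" and \<Phi>_mono: "mono_on {0..1} \<Phi>"
    and p: "1 < p" and "0 < r0" and V_nonneg: "\<And>r. r0 \<le> r \<Longrightarrow> 0 \<le> V r" and V_pos: "\<And>r. r0 < r \<Longrightarrow> 0 < V r"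
    and V_growth: "\<And>s t. r0 \<le> s \<Longrightarrow> s \<le> t \<Longrightarrow> V s \<le> (s / t) powr p * V t"
  shows "\<exists>C>0. \<forall>u. eharmonic_on u (UNIV - \<real>) \<longrightarrow>
    (\<forall>r\<ge>r0. enn2ereal (\<integral>\<^sup>+ \<theta>\<in>{-pi..pi}.
        e2ennreal (max (- u (rcis r \<theta>)) 0) * ennreal (\<Phi> \<bar>sin \<theta>\<bar>) \<partial>lborel) \<le> ereal (V r)) \<longrightarrow>
    (\<exists>R0>0. \<forall>z. R0 \<le> cmod z \<longrightarrow> Im z \<noteq> 0 \<longrightarrow> (\<exists>x. u z = ereal x \<and>
       x * ((\<bar>Im z\<bar> / cmod z) ^ 3 * \<Phi> (\<bar>Im z\<bar> / cmod z / 8)) \<le> C * V (exp 4 * cmod z)))"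
proof -
  have "\<exists>C>0. \<forall>F. F holomorphic_on strip \<longrightarrow> weighted_negative_mass_le \<Phi> (ln r0) (\<lambda>\<xi>. V (exp \<xi>)) F \<longrightarrow>
       (\<exists>\<xi>1. \<forall>\<xi>\<ge>\<xi>1. \<forall>y. 0 < y \<longrightarrow> y < pi \<longrightarrow>
          Re (F (Complex \<xi> y)) * (sin y ^ 3 * \<Phi> (sin y / 8)) \<le> C * V (exp (\<xi> + 4)))"
  proof (rule strip_upper_bound[OF \<Phi> \<Phi>_mono p])
    fix s t assume s: "ln r0 \<le> s" "s \<le> t"
    have "exp (ln r0) \<le> exp s" using s by (simp only: exp_le_cancel_iff)
    then have "V (exp s) \<le> (exp s / exp t) powr p * V (exp t)"
      using s \<open>0 < r0\<close> by (intro V_growth) auto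
    then show "V (exp s) \<le> exp (p * (s - t)) * V (exp t)"
      by (simp add: powr_def ln_div)
  next
    fix \<xi> assume "ln r0 \<le> \<xi>"
    then have "exp (ln r0) \<le> exp \<xi>" by (simp only: exp_le_cancel_iff)
    then show "0 \<le> V (exp \<xi>)" using \<open>0 < r0\<close> by (intro V_nonneg) simp
  next
    fix \<xi> assume "ln r0 < \<xi>"
    then have "exp (ln r0) < exp \<xi>" by (simp only: exp_less_cancel_iff)
    then show "0 < V (exp \<xi>)" using \<open>0 < r0\<close> by (intro V_pos) simp
  qed
  then obtain C where "0 < C" and C: "\<And>F. F holomorphic_on strip \<Longrightarrow> weighted_negative_mass_le \<Phi> (ln r0) (\<lambda>\<xi>. V (exp \<xi>)) F \<Longrightarrow>
       (\<exists>\<xi>1. \<forall>\<xi>\<ge>\<xi>1. \<forall>y. 0 < y \<longrightarrow> y < pi \<longrightarrow>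
          Re (F (Complex \<xi> y)) * (sin y ^ 3 * \<Phi> (sin y / 8)) \<le> C * V (exp (\<xi> + 4)))"
    by auto
  show ?thesis
  proof (rule exI[of _ C], intro conjI allI impI)
    show "0 < C" by fact
    fix u assume u: "eharmonic_on u (UNIV - \<real>)"
      and mass: "\<forall>r\<ge>r0. enn2ereal (\<integral>\<^sup>+ \<theta>\<in>{-pi..pi}.
        e2ennreal (max (- u (rcis r \<theta>)) 0) * ennreal (\<Phi> \<bar>sin \<theta>\<bar>) \<partial>lborel) \<le> ereal (V r)"
    obtain F1 F2 where F: "F1 holomorphic_on strip" "F2 holomorphic_on strip"
      and F1: "\<And>\<xi> y. 0 < y \<Longrightarrow> y < pi \<Longrightarrow> u (rcis (exp \<xi>) y) = ereal (Re (F1 (Complex \<xi> y)))"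
      and F2: "\<And>\<xi> y. 0 < y \<Longrightarrow> y < pi \<Longrightarrow> u (rcis (exp \<xi>) (- y)) = ereal (Re (F2 (Complex \<xi> y)))"
      using half_plane_traces[OF u] by blast
    have "weighted_negative_mass_le \<Phi> (ln r0) (\<lambda>\<xi>. V (exp \<xi>)) F1"
      using mass F1 by (intro weighted_negative_mass_le_trace[OF F(1), of 1 u] \<Phi> \<Phi>_mono \<open>0 < r0\<close>) auto
    from C[OF F(1) this] obtain \<xi>1 where 1: "\<And>\<xi> y. \<xi>1 \<le> \<xi> \<Longrightarrow> 0 < y \<Longrightarrow> y < pi \<Longrightarrow>
        Re (F1 (Complex \<xi> y)) * (sin y ^ 3 * \<Phi> (sin y / 8)) \<le> C * V (exp (\<xi> + 4))" by auto
    have "weighted_negative_mass_le \<Phi> (ln r0) (\<lambda>\<xi>. V (exp \<xi>)) F2"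
      using mass F2 by (intro weighted_negative_mass_le_trace[OF F(2), of "- 1" u] \<Phi> \<Phi>_mono \<open>0 < r0\<close>) auto
    from C[OF F(2) this] obtain \<xi>2 where 2: "\<And>\<xi> y. \<xi>2 \<le> \<xi> \<Longrightarrow> 0 < y \<Longrightarrow> y < pi \<Longrightarrow>
        Re (F2 (Complex \<xi> y)) * (sin y ^ 3 * \<Phi> (sin y / 8)) \<le> C * V (exp (\<xi> + 4))" by auto
    show "\<exists>R0>0. \<forall>z. R0 \<le> cmod z \<longrightarrow> Im z \<noteq> 0 \<longrightarrow> (\<exists>x. u z = ereal x \<and>
       x * ((\<bar>Im z\<bar> / cmod z) ^ 3 * \<Phi> (\<bar>Im z\<bar> / cmod z / 8)) \<le> C * V (exp 4 * cmod z))"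
    proof (rule exI[of _ "exp (max \<xi>1 \<xi>2)"], intro conjI allI impI)
      fix z assume z: "exp (max \<xi>1 \<xi>2) \<le> cmod z" and im: "Im z \<noteq> 0"
      define \<xi> where "\<xi> = ln (cmod z)"
      have zpos: "0 < cmod z" using im by auto
      have e: "exp \<xi> = cmod z" using zpos by (simp add: \<xi>_def)
      have "max \<xi>1 \<xi>2 \<le> \<xi>" using z by (simp only: e[symmetric] exp_le_cancel_iff)
      then have \<xi>: "\<xi>1 \<le> \<xi>" "\<xi>2 \<le> \<xi>" by auto
      have v: "V (exp (\<xi> + 4)) = V (exp 4 * cmod z)" by (simp add: exp_add e mult.commute)
      have z_eq: "z = rcis (exp \<xi>) (Arg z)" by (simp add: e rcis_cmod_Arg)
      have Arg: "- pi < Arg z" "Arg z \<le> pi" using Arg_bounded[of z] by auto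
      have im_eq: "Im z = cmod z * sin (Arg z)" by (metis z_eq e Im_rcis)
      show "\<exists>x. u z = ereal x \<and>
         x * ((\<bar>Im z\<bar> / cmod z) ^ 3 * \<Phi> (\<bar>Im z\<bar> / cmod z / 8)) \<le> C * V (exp 4 * cmod z)"
      proof (cases "0 < Arg z")
        case True
        have y: "Arg z < pi" using Arg im im_eq by (cases "Arg z = pi") auto
        have "\<bar>Im z\<bar> / cmod z = sin (Arg z)"
          using sin_gt_zero[OF True y] zpos unfolding im_eq by (simp add: abs_mult)
        then show ?thesis using F1[OF True y, of \<xi>] 1[OF \<xi>(1) True y] v z_eq by auto
      next
        case False
        have y: "0 < - Arg z" "- Arg z < pi" using False Arg im im_eq by (cases "Arg z = 0"; auto)+
        have "\<bar>Im z\<bar> / cmod z = sin (- Arg z)"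
          using sin_gt_zero[OF y] zpos unfolding im_eq by (simp add: abs_mult)
        then show ?thesis using F2[OF y, of \<xi>] 2[OF \<xi>(2) y] v z_eq by auto
      qed
    qed simp
  qed
qed

section \<open>Domar's argument across the real axis\<close>

text \<open>
  Layer-cake formula: for \<open>n \<ge> 1\<close> let \<open>a n\<close> be the width of the interval on which \<open>\<Phi> < 2\<^sup>-\<^sup>n\<close>. A point \<open>s\<close>
  lies in at most \<open>log\<^sup>- (\<Phi> s) / ln 2\<close> of these intervals, so the sum of the widths is at most
  \<open>1 / ln 2\<close> times the integral of \<open>log\<^sup>- \<Phi>\<close>.
\<close>

lemma L_minus_mono_level_widths:
  assumes "\<Phi> \<in> L_minus 0 1" and mono: "mono_on {0..1} \<Phi>"
  obtains \<tau> :: "nat \<Rightarrow> real" where "summable \<tau>" "\<And>n. 0 < \<tau> n"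
    "\<And>n t. \<tau> n \<le> t \<Longrightarrow> t \<le> 1 \<Longrightarrow> (1 / 2) ^ n \<le> \<Phi> t"
proof -
  have nonneg: "\<And>s. s \<in> {0..1} \<Longrightarrow> 0 \<le> \<Phi> s"
    and fin: "(\<integral>\<^sup>+ s\<in>{0..1}. log_minus (\<Phi> s) \<partial>lebesgue) < \<infinity>"
    using assms(1) by (auto simp: L_minus_def)
  define E where "E = (\<lambda>n::nat. insert 0 {t \<in> {0..1}. \<Phi> t < (1 / 2) ^ n})"
  define a where "a = (\<lambda>n. Sup (E n))"
  have bdd: "bdd_above (E n)" for n by (rule bdd_aboveI[of _ 1]) (auto simp: E_def)
  have a0: "0 \<le> a n" for n unfolding a_def by (rule cSup_upper[OF _ bdd]) (simp add: E_def)
  have above: "(1 / 2) ^ n \<le> \<Phi> t" if "a n < t" "t \<le> 1" for n t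
  proof (rule ccontr)
    assume "\<not> ?thesis"
    then have "t \<in> E n" using that a0[of n] by (auto simp: E_def)
    then have "t \<le> a n" unfolding a_def by (rule cSup_upper[OF _ bdd])
    then show False using that by simp
  qed
  have below: "\<Phi> t < (1 / 2) ^ n" if t: "0 \<le> t" "t < a n" for n t
  proof -
    have "E n \<noteq> {}" by (simp add: E_def)
    then obtain t' where t': "t' \<in> E n" "t < t'"
      using t(2) less_cSup_iff[OF _ bdd, of n t] unfolding a_def by auto
    then have "t' \<in> {0..1}" "\<Phi> t' < (1 / 2) ^ n" using t by (auto simp: E_def)
    moreover have "\<Phi> t \<le> \<Phi> t'" using mono t' t calculation by (auto simp: mono_on_def)
    ultimately show ?thesis by simp
  qed
  have a1: "a n \<le> 1" for n
    unfolding a_def by (rule cSup_least) (auto simp: E_def)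
  have count: "(\<Sum>n<N. ennreal (ln 2) * indicator {0..<a (Suc n)} s) \<le> log_minus (\<Phi> s) * indicator {0..1} s"
    for N s
  proof (cases "s \<in> {0..1}")
    case False
    then have "indicator {0..<a (Suc n)} s = (0::ennreal)" for n
      using a1[of "Suc n"] by (auto simp: indicator_def)
    then show ?thesis by simp
  next
    case s: True
    show ?thesis
    proof (cases "\<Phi> s = 0")
      case True
      then show ?thesis using s by (simp add: log_minus_def)
    next
      case False
      with nonneg[OF s] have pos: "0 < \<Phi> s" by simp
      define K where "K = {n. n < N \<and> s < a (Suc n)}"
      define k where "k = nat \<lfloor>- ln (\<Phi> s) / ln 2\<rfloor>"
      have "n < k" if "n \<in> K" for n
      proof -
        have "\<Phi> s < (1 / 2) ^ Suc n" using that s below[of s "Suc n"] unfolding K_def by simp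
        then have "ln (\<Phi> s) < ln ((1 / 2) ^ Suc n)" using pos by (subst ln_less_cancel_iff) auto
        also have "\<dots> = - real (Suc n) * ln 2" by (subst ln_realpow) (auto simp: ln_div algebra_simps)
        finally have "real (Suc n) < - ln (\<Phi> s) / ln 2" by (simp add: field_simps)
        then show "n < k" unfolding k_def by linarith
      qed
      then have "K \<subseteq> {..<k}" by auto
      then have "card K \<le> k" using card_mono[of "{..<k}" K] by simp
      moreover have "ln 2 * real k \<le> max (- ln (\<Phi> s)) 0"
      proof (cases "0 \<le> - ln (\<Phi> s) / ln 2")
        case True
        then have "real k \<le> - ln (\<Phi> s) / ln 2" unfolding k_def by linarith
        then have "ln 2 * real k \<le> - ln (\<Phi> s)" by (simp add: field_simps)
        then show ?thesis by simp
      next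
        case False
        then have "k = 0" unfolding k_def by linarith
        then show ?thesis by simp
      qed
      ultimately have le: "ln 2 * real (card K) \<le> max (- ln (\<Phi> s)) 0"
        by (smt (verit) ln_gt_zero mult_left_mono of_nat_le_iff)
      have "(\<Sum>n<N. ennreal (ln 2) * indicator {0..<a (Suc n)} s) = (\<Sum>n<N. if n \<in> K then ennreal (ln 2) else 0)"
        using s by (intro sum.cong) (auto simp: K_def indicator_def)
      also have "\<dots> = (\<Sum>n\<in>{..<N} \<inter> K. ennreal (ln 2))" by (simp add: sum.If_cases)
      also have "{..<N} \<inter> K = K" by (auto simp: K_def)
      also have "(\<Sum>n\<in>K. ennreal (ln 2)) = ennreal (ln 2 * real (card K))"
        by (simp add: ennreal_mult ennreal_of_nat_eq_real_of_nat mult.commute)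
      also have "\<dots> \<le> ennreal (max (- ln (\<Phi> s)) 0)" using le by (rule ennreal_leI)
      finally show ?thesis using s False by (simp add: log_minus_def)
    qed
  qed
  obtain J where J: "(\<integral>\<^sup>+ s\<in>{0..1}. log_minus (\<Phi> s) \<partial>lebesgue) = ennreal J" "0 \<le> J"
    using fin by (cases "\<integral>\<^sup>+ s\<in>{0..1}. log_minus (\<Phi> s) \<partial>lebesgue") auto
  have bound: "(\<Sum>n<N. a (Suc n)) \<le> J / ln 2" for N
  proof -
    have "ennreal (ln 2 * (\<Sum>n<N. a (Suc n))) = (\<Sum>n<N. ennreal (ln 2) * ennreal (a (Suc n)))"
      using a0 by (simp add: sum_distrib_left ennreal_mult flip: sum_ennreal)
    also have "\<dots> = (\<Sum>n<N. \<integral>\<^sup>+s. ennreal (ln 2) * indicator {0..<a (Suc n)} s \<partial>lebesgue)"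
      using a0 by (simp add: nn_integral_cmult_indicator)
    also have "\<dots> = (\<integral>\<^sup>+s. (\<Sum>n<N. ennreal (ln 2) * indicator {0..<a (Suc n)} s) \<partial>lebesgue)"
      by (intro nn_integral_sum[symmetric] borel_measurable_times_ennreal borel_measurable_indicator)
        (auto intro: sets_completionI_sets)
    also have "\<dots> \<le> ennreal J"
      unfolding J(1)[symmetric] by (intro nn_integral_mono count)
    finally have "ln 2 * (\<Sum>n<N. a (Suc n)) \<le> J" using J(2) by simp
    then show ?thesis by (simp add: field_simps)
  qed
  have "summable (\<lambda>n. a (Suc n))"
    by (rule summableI_nonneg_bounded[OF a0 bound])
  then have "summable a" by (simp only: summable_Suc_iff)
  show ?thesis
  proof
    (* the extra term makes the widths positive and moves the end point of the interval inside *)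
    show "summable (\<lambda>n. a n + (1 / 2) ^ n)"
      by (intro summable_add \<open>summable a\<close> summable_geometric) simp
    show "0 < a n + (1 / 2) ^ n" for n using a0[of n] by (simp add: add_nonneg_pos)
    show "(1 / 2) ^ n \<le> \<Phi> t" if "a n + (1 / 2) ^ n \<le> t" "t \<le> 1" for n t
      using above[of n t] that by (smt (verit) zero_less_power half_gt_zero_iff)
  qed
qed

lemma emeasure_lborel_le_diameter:
  assumes "0 \<le> D" "\<And>x y. x \<in> S \<Longrightarrow> y \<in> S \<Longrightarrow> x \<le> y \<Longrightarrow> y - x \<le> (D::real)"
  shows "emeasure lborel S \<le> ennreal D"
proof (cases "S = {}")
  case False
  then obtain x0 where "x0 \<in> S" by blast
  have lower: "x0 - D \<le> x" if "x \<in> S" for x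
    using assms(1) assms(2)[OF that \<open>x0 \<in> S\<close>] by (cases "x \<le> x0") auto
  then have bdd: "bdd_below S" by (rule bdd_belowI)
  have "S \<subseteq> {Inf S .. Inf S + D}"
  proof
    fix y assume y: "y \<in> S"
    have "y - D \<le> Inf S"
    proof (rule cInf_greatest[OF False])
      fix x assume "x \<in> S"
      then show "y - D \<le> x" using assms(1) assms(2)[OF \<open>x \<in> S\<close> y] by (cases "x \<le> y") auto
    qed
    then show "y \<in> {Inf S .. Inf S + D}" using cInf_lower[OF y bdd] by auto
  qed
  then have "emeasure lborel S \<le> emeasure lborel {Inf S .. Inf S + D}" by (intro emeasure_mono) auto
  then show ?thesis using assms(1) by simp
qed simp

text \<open>
  Near the points where the sine is stationary, it separates points only quadratically; this is where
  the square root comes from.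
\<close>

lemma sin_diff_le_imp_close:
  fixes x y \<eta> :: real
  assumes "- pi / 2 \<le> x" "x \<le> y" "y \<le> pi / 2" "sin y - sin x \<le> 2 * \<eta>"
  shows "y - x \<le> 4 * sqrt \<eta>"
proof -
  let ?d = "(y - x) / 2" and ?m = "(y + x) / 2"
  have "sin ?d \<le> cos ?m"
  proof -
    have "cos (pi / 2 - ?d) \<le> cos \<bar>?m\<bar>"
      using assms by (intro cos_monotone_0_pi_le) (auto simp: abs_le_iff field_simps)
    moreover have "cos (pi / 2 - ?d) = sin ?d" by (simp add: cos_diff)
    ultimately show ?thesis by (simp only: cos_abs_real)
  qed
  moreover have s: "?d / 2 \<le> sin ?d" using assms by (intro sin_ge_half) auto
  moreover have "0 \<le> ?d" using assms by simp
  ultimately have "(?d / 2) * (?d / 2) \<le> sin ?d * cos ?m"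
    by (intro mult_mono) auto
  also have "\<dots> = (sin y - sin x) / 2" by (simp add: sin_diff_sin)
  finally have "(?d / 2)\<^sup>2 \<le> \<eta>" using assms by (simp add: power2_eq_square)
  then have "?d / 2 \<le> sqrt \<eta>" by (rule real_le_rsqrt)
  then show ?thesis by simp
qed

text \<open>
  A circle spends little time near a line: the worst case is tangency, where the time is of the
  order of the square root of the relative distance. The circle is cut into three arcs on which the
  sine is monotone.
\<close>

lemma emeasure_circle_near_line:
  fixes a \<eta> :: real
  assumes "0 \<le> \<eta>"
  shows "emeasure lborel {t \<in> {-pi..pi}. \<bar>a + sin t\<bar> \<le> \<eta>} \<le> ennreal (12 * sqrt \<eta>)"
proof -
  define A where "A = (\<lambda>l r. {t \<in> {l..r}. \<bar>a + sin t\<bar> \<le> \<eta>})"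
  have meas: "A l r \<in> sets lborel" for l r
    unfolding A_def by measurable
  have 1: "emeasure lborel (A (- pi / 2) (pi / 2)) \<le> ennreal (4 * sqrt \<eta>)"
  proof (rule emeasure_lborel_le_diameter)
    fix x y assume "x \<in> A (- pi / 2) (pi / 2)" "y \<in> A (- pi / 2) (pi / 2)" "x \<le> y"
    then show "y - x \<le> 4 * sqrt \<eta>"
      by (intro sin_diff_le_imp_close) (auto simp: A_def abs_le_iff)
  qed (use assms in simp)
  have 2: "emeasure lborel (A (pi / 2) pi) \<le> ennreal (4 * sqrt \<eta>)"
  proof (rule emeasure_lborel_le_diameter)
    fix x y assume "x \<in> A (pi / 2) pi" "y \<in> A (pi / 2) pi" "x \<le> y"
    then have "(pi - x) - (pi - y) \<le> 4 * sqrt \<eta>"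
      by (intro sin_diff_le_imp_close) (auto simp: A_def abs_le_iff)
    then show "y - x \<le> 4 * sqrt \<eta>" by simp
  qed (use assms in simp)
  have 3: "emeasure lborel (A (- pi) (- pi / 2)) \<le> ennreal (4 * sqrt \<eta>)"
  proof (rule emeasure_lborel_le_diameter)
    fix x y assume "x \<in> A (- pi) (- pi / 2)" "y \<in> A (- pi) (- pi / 2)" "x \<le> y"
    moreover have "sin (- pi - t) = sin t" for t by (simp add: sin_diff)
    ultimately have "(- pi - x) - (- pi - y) \<le> 4 * sqrt \<eta>"
      by (intro sin_diff_le_imp_close) (auto simp: A_def abs_le_iff)
    then show "y - x \<le> 4 * sqrt \<eta>" by simp
  qed (use assms in simp)
  have "{t \<in> {-pi..pi}. \<bar>a + sin t\<bar> \<le> \<eta>} = (A (- pi / 2) (pi / 2) \<union> A (pi / 2) pi) \<union> A (- pi) (- pi / 2)"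
    by (auto simp: A_def) 
  then have "emeasure lborel {t \<in> {-pi..pi}. \<bar>a + sin t\<bar> \<le> \<eta>}
      \<le> (emeasure lborel (A (- pi / 2) (pi / 2)) + emeasure lborel (A (pi / 2) pi)) + emeasure lborel (A (- pi) (- pi / 2))"
    using meas by (auto intro!: order_trans[OF emeasure_subadditive] add_right_mono emeasure_subadditive)
  also have "\<dots> \<le> (ennreal (4 * sqrt \<eta>) + ennreal (4 * sqrt \<eta>)) + ennreal (4 * sqrt \<eta>)"
    by (intro add_mono 1 2 3)
  also have "\<dots> = ennreal (12 * sqrt \<eta>)" using assms by (simp flip: ennreal_plus)
  finally show ?thesis .
qed

text \<open>
  For the relative width \<open>1 / 4096 = 2\<^sup>-\<^sup>1\<^sup>2\<close> the exceptional angles have measure at most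
  \<open>12 / 64 = 3 / 16\<close>, which is less than one part in \<open>32\<close> of the full circle.
\<close>

lemma circle_mean_le_near_line:
  assumes "0 < \<rho>" "0 \<le> b" "0 \<le> M"
    and M: "\<And>w. dist z w = \<rho> \<Longrightarrow> u w \<le> ereal M"
    and b: "\<And>w. dist z w = \<rho> \<Longrightarrow> \<rho> / 4096 < \<bar>Im w\<bar> \<Longrightarrow> u w \<le> ereal b"
  shows "circle_mean u z \<rho> \<le> ereal (b + M / 32)"
proof -
  define T where "T = {t \<in> {-pi..pi}. \<bar>Im z / \<rho> + sin t\<bar> \<le> 1 / 4096}"
  have T: "emeasure lborel T \<le> ennreal (3 / 16)" "T \<in> sets lborel"
  proof -
    have "sqrt (1 / 4096) = (1 / 64 :: real)" by (rule real_sqrt_unique) (auto simp: power2_eq_square)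
    then have "12 * sqrt (1 / 4096) = (3 / 16 :: real)" by simp
    then show "emeasure lborel T \<le> ennreal (3 / 16)"
      using emeasure_circle_near_line[of "1 / 4096" "Im z / \<rho>"] unfolding T_def by (simp only:)
    show "T \<in> sets lborel" unfolding T_def by measurable
  qed
  have pt: "e2ennreal (max (u (z + rcis \<rho> t)) 0) * indicator {-pi..pi} t
      \<le> ennreal b * indicator {-pi..pi} t + ennreal M * indicator T t" for t
  proof (cases "t \<in> {-pi..pi}")
    case t: True
    have d: "dist z (z + rcis \<rho> t) = \<rho>" using assms(1) by (simp add: dist_norm)
    show ?thesis
    proof (cases "t \<in> T")
      case True
      have "max (u (z + rcis \<rho> t)) 0 \<le> ereal M" using M[OF d] assms by simp
      then have "e2ennreal (max (u (z + rcis \<rho> t)) 0) \<le> ennreal M"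
        using e2ennreal_mono[of "max (u (z + rcis \<rho> t)) 0" "ereal M"] by (simp add: e2ennreal_ereal)
      then show ?thesis using True t by (simp add: add_increasing)
    next
      case False
      then have "1 / 4096 < \<bar>Im z / \<rho> + sin t\<bar>" using t by (simp add: T_def)
      then have "\<rho> / 4096 < \<rho> * \<bar>Im z / \<rho> + sin t\<bar>" using assms(1) by (simp add: field_simps)
      also have "\<dots> = \<bar>Im (z + rcis \<rho> t)\<bar>"
        using assms(1) abs_mult[of \<rho> "Im z / \<rho> + sin t"] by (simp add: distrib_left)
      finally have "max (u (z + rcis \<rho> t)) 0 \<le> ereal b" using b[OF d] assms by simp
      then have "e2ennreal (max (u (z + rcis \<rho> t)) 0) \<le> ennreal b"
        using e2ennreal_mono[of "max (u (z + rcis \<rho> t)) 0" "ereal b"] by (simp add: e2ennreal_ereal)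
      then show ?thesis using False t by simp
    qed
  qed simp
  define P where "P = (\<integral>\<^sup>+ t\<in>{-pi..pi}. e2ennreal (max (u (z + rcis \<rho> t)) 0) \<partial>lborel)"
  define Q where "Q = (\<integral>\<^sup>+ t\<in>{-pi..pi}. e2ennreal (max (- u (z + rcis \<rho> t)) 0) \<partial>lborel)"
  have "P \<le> (\<integral>\<^sup>+ t. ennreal b * indicator {-pi..pi} t + ennreal M * indicator T t \<partial>lborel)"
    unfolding P_def by (intro nn_integral_mono pt)
  also have "\<dots> = ennreal b * ennreal (2 * pi) + ennreal M * emeasure lborel T"
    using T by (subst nn_integral_add) (auto simp: nn_integral_cmult_indicator)
  also have "\<dots> \<le> ennreal b * ennreal (2 * pi) + ennreal M * ennreal (3 / 16)"
    using T by (intro add_left_mono mult_left_mono) auto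
  also have "\<dots> = ennreal (b * (2 * pi) + M * (3 / 16))"
  proof -
    have 1: "ennreal b * ennreal (2 * pi) = ennreal (b * (2 * pi))"
      "ennreal M * ennreal (3 / 16) = ennreal (M * (3 / 16))"
      using assms by (intro ennreal_mult[symmetric]; simp)+
    show ?thesis unfolding 1 using assms by (intro ennreal_plus[symmetric]) auto
  qed
  finally have "enn2ereal P \<le> enn2ereal (ennreal (b * (2 * pi) + M * (3 / 16)))"
    by (simp only: less_eq_ennreal.rep_eq)
  then have P: "enn2ereal P \<le> ereal (b * (2 * pi) + M * (3 / 16))"
    using assms by (subst (asm) enn2ereal_ennreal) auto
  have "circle_mean u z \<rho> = (enn2ereal P - enn2ereal Q) / ereal (2 * pi)"
    by (simp add: circle_mean_def P_def Q_def)
  also have "\<dots> \<le> enn2ereal P / ereal (2 * pi)"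
  proof (rule ereal_divide_right_mono)
    have "enn2ereal P - enn2ereal Q \<le> enn2ereal P - 0" by (intro ereal_minus_mono) auto
    then show "enn2ereal P - enn2ereal Q \<le> enn2ereal P" by simp
  qed simp
  also have "\<dots> \<le> ereal (b * (2 * pi) + M * (3 / 16)) / ereal (2 * pi)"
    using P by (intro ereal_divide_right_mono) auto
  also have "\<dots> \<le> ereal (b + M / 32)"
  proof -
    have "M * (3 / 16) \<le> M / 32 * (2 * pi)" using pi_gt3 assms(3) mult_left_mono[of 3 pi M] by simp
    then have "(b * (2 * pi) + M * (3 / 16)) / (2 * pi) \<le> b + M / 32"
      by (simp add: divide_le_eq distrib_right)
    then show ?thesis by simp
  qed
  finally show ?thesis .
qed

text \<open>
  Domar's argument. Suppose \<open>u > 4 B 4\<^sup>n\<close> at a point. On the circle of radius \<open>4096 w n\<close> about it,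
  \<open>u \<le> B 4\<^sup>n\<close> outside the band of half-width \<open>w n\<close>, and the band takes up less than \<open>1 / 32\<close> of the circle.
  If \<open>u \<le> 16 B 4\<^sup>n\<close> held on the whole circle, the mean would be at most \<open>B 4\<^sup>n + B 4\<^sup>n / 2\<close>, which is too
  small. So \<open>u\<close> exceeds the next level somewhere on the circle. The sequence obtained in this way has
  summable steps and stays in the disc of radius \<open>R\<close>; near its limit \<open>u\<close> is unbounded, which upper
  semicontinuity forbids.
\<close>

lemma domar_bound:
  fixes u :: "complex \<Rightarrow> ereal" and w :: "nat \<Rightarrow> real"
  assumes usc: "\<And>a. open {z. u z < a}" and fin: "\<And>z. u z < \<infinity>"
    and submean: "\<And>z \<rho>. 0 < \<rho> \<Longrightarrow> u z \<le> circle_mean u z \<rho>"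
    and w: "summable w" "\<And>n. 0 < w n" and "0 < B"
    and bound: "\<And>n z'. dist z z' \<le> R \<Longrightarrow> w n < \<bar>Im z'\<bar> \<Longrightarrow> u z' \<le> ereal (B * 4 ^ n)"
    and R: "4096 * (\<Sum>n. w (n + N)) \<le> R"
  shows "u z \<le> ereal (B * 4 ^ (N + 1))"
proof (rule ccontr)
  assume "\<not> ?thesis"
  then have start: "ereal (B * 4 ^ (N + 1)) < u z" by simp
  define v where "v = (\<lambda>n. w (n + N))"
  have v: "summable v" "\<And>n. 0 < v n" using w by (auto simp: v_def summable_iff_shift)
  have partial: "4096 * (\<Sum>i<n. v i) \<le> R" for n
  proof -
    have "(\<Sum>i<n. v i) \<le> (\<Sum>n. v n)" using v by (intro sum_le_suminf) (auto intro: less_imp_le)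
    then show ?thesis using R by (simp add: v_def)
  qed
  let ?P = "\<lambda>n x. ereal (B * 4 ^ (n + N + 1)) < u x \<and> dist z x \<le> 4096 * (\<Sum>i<n. v i)"
  have "\<exists>x. \<forall>n. ?P n (x n) \<and> dist (x n) (x (Suc n)) = 4096 * v n"
  proof (rule dependent_nat_choice)
    show "\<exists>x. ?P 0 x" using start by (intro exI[of _ z]) simp
    fix x n assume x: "?P n x"
    have near: "dist z y \<le> 4096 * (\<Sum>i<Suc n. v i)" if "dist x y = 4096 * v n" for y
      using dist_triangle[of z y x] x that by (simp add: dist_commute distrib_left)
    have "\<exists>y. dist x y = 4096 * v n \<and> ereal (B * 4 ^ (Suc n + N + 1)) < u y"
    proof (rule ccontr)
      assume "\<not> ?thesis"
      then have "u y \<le> ereal (B * 4 ^ (Suc n + N + 1))" if "dist x y = 4096 * v n" for y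
        using that by (meson not_less)
      moreover have "u y \<le> ereal (B * 4 ^ (n + N))" if "dist x y = 4096 * v n" "4096 * v n / 4096 < \<bar>Im y\<bar>" for y
        using that near[of y] partial[of "Suc n"] by (intro bound) (auto simp: v_def)
      ultimately have "circle_mean u x (4096 * v n) \<le> ereal (B * 4 ^ (n + N) + B * 4 ^ (Suc n + N + 1) / 32)"
        using v(2)[of n] \<open>0 < B\<close> by (intro circle_mean_le_near_line) auto
      also have "\<dots> \<le> ereal (B * 4 ^ (n + N + 1))" using \<open>0 < B\<close> by simp
      finally have "u x \<le> ereal (B * 4 ^ (n + N + 1))"
        using submean[of "4096 * v n" x] v(2)[of n] by (meson mult_pos_pos order_trans zero_less_numeral)
      then show False using x by (meson not_less)
    qed
    then show "\<exists>y. ?P (Suc n) y \<and> dist x y = 4096 * v n" using near by blast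
  qed
  then obtain x where x: "\<And>n. ereal (B * 4 ^ (n + N + 1)) < u (x n)"
    and step: "\<And>n. dist (x n) (x (Suc n)) = 4096 * v n" by blast
  have "summable (\<lambda>n. norm (x (Suc n) - x n))"
    using summable_mult[OF v(1), of 4096] step by (simp add: dist_norm norm_minus_commute)
  then have "summable (\<lambda>n. x (Suc n) - x n)" by (rule summable_norm_cancel)
  then have "convergent (\<lambda>n. \<Sum>i<n. x (Suc i) - x i)" by (simp add: summable_iff_convergent)
  then have "convergent (\<lambda>n. x n - x 0)" by (simp add: sum_lessThan_telescope)
  then have "convergent x" using convergent_add[of "\<lambda>n. x n - x 0" "\<lambda>_. x 0"] by (simp add: convergent_const)
  then obtain l where l: "x \<longlonglongrightarrow> l" by (auto simp: convergent_def)
  obtain c :: real where c: "u l < ereal c" using fin[of l] less_PInf_Ex_of_nat[of "u l"] by auto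
  then have "\<forall>\<^sub>F n in sequentially. x n \<in> {z. u z < ereal c}"
    using topological_tendstoD[OF l usc[of "ereal c"]] by simp
  moreover have "\<forall>\<^sub>F n in sequentially. c / B < 4 ^ n"
  proof -
    obtain m where "c / B < 4 ^ m" using real_arch_pow[of 4 "c / B"] by auto
    then have "c / B < 4 ^ n" if "m \<le> n" for n
      by (rule less_le_trans) (use that in \<open>simp add: power_increasing\<close>)
    then show ?thesis by (auto simp: eventually_sequentially)
  qed
  ultimately have "\<forall>\<^sub>F n in sequentially. False"
  proof eventually_elim
    case (elim n)
    have "ereal (B * 4 ^ (n + N + 1)) < ereal c" using x[of n] elim(1) by (metis less_trans mem_Collect_eq)
    moreover have "c < B * 4 ^ n" using elim \<open>0 < B\<close> by (simp add: field_simps)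
    moreover have "B * 4 ^ n \<le> B * 4 ^ (n + N + 1)"
      using \<open>0 < B\<close> by (intro mult_left_mono power_increasing) auto
    ultimately show False by simp
  qed
  then show False by simp
qed

section \<open>The growth theorem\<close>

text \<open>
  The weight \<open>t\<^sup>3 \<Phi> (t/8)\<close> of \<open>off_axis_bound\<close> is at least \<open>4\<^sup>-\<^sup>n\<close> as soon as both factors are at least
  \<open>2\<^sup>-\<^sup>n\<close>; hence the widths \<open>8 \<tau> n + c\<^sup>n\<close> with \<open>c\<^sup>3 = 1 / 2\<close>. Since they are relative to \<open>\<bar>z\<bar>\<close>, one
  index \<open>N\<close> serves for all radii, and Domar's argument on the disc of radius \<open>r / 2\<close> about a point of
  modulus \<open>r\<close> loses only the factor \<open>4\<^sup>N\<^sup>+\<^sup>1\<close>.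
\<close>

theorem theorem4:
  fixes \<Phi> V :: "real \<Rightarrow> real" and r0 :: real
  assumes "\<Phi> \<in> L_minus 0 1"
    and "mono_on {0..1} \<Phi>"
    and "0 < r0"
    and "\<exists>\<delta>>0. strict_mono_on {0<..} (\<lambda>r. r powr (- 1 - \<delta>) * V r)"
  shows "\<exists>c>0. \<exists>A\<ge>1. \<forall>u :: complex \<Rightarrow> ereal.
    subharmonic_on u UNIV \<longrightarrow> eharmonic_on u (UNIV - \<real>) \<longrightarrow>
    (\<forall>r\<ge>r0. enn2ereal (\<integral>\<^sup>+ \<theta>\<in>{-pi..pi}.
        e2ennreal (max (- u (rcis r \<theta>)) 0) * ennreal (\<Phi> \<bar>sin \<theta>\<bar>) \<partial>lborel) \<le> ereal (V r)) \<longrightarrow>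
    (\<exists>r1>0. \<forall>r\<ge>r1. \<forall>\<theta>\<in>{-pi..pi}. u (rcis r \<theta>) \<le> ereal (c * V (A * r)))"
proof -
  obtain \<delta> where "0 < \<delta>" and inc: "strict_mono_on {0<..} (\<lambda>r. r powr (- 1 - \<delta>) * V r)"
    using assms(4) by blast
  define p where "p = 1 + \<delta>"
  have p: "1 < p" using \<open>0 < \<delta>\<close> by (simp add: p_def)
  have inc': "s powr (- p) * V s < t powr (- p) * V t" if "0 < s" "s < t" for s t
    using strict_mono_onD[OF inc, of s t] that by (simp add: p_def)
  obtain \<tau> :: "nat \<Rightarrow> real" where \<tau>: "summable \<tau>" "\<And>n. 0 < \<tau> n"
    "\<And>n t. \<tau> n \<le> t \<Longrightarrow> t \<le> 1 \<Longrightarrow> (1 / 2) ^ n \<le> \<Phi> t"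
    using L_minus_mono_level_widths[OF assms(1,2)] by blast
  have \<Phi>: "0 < \<Phi> s" if s: "0 < s" "s \<le> 1" for s
  proof -
    have "\<forall>\<^sub>F n in sequentially. \<tau> n < s"
      using order_tendstoD(2)[OF summable_LIMSEQ_zero[OF \<tau>(1)] s(1)] .
    then obtain n where "\<tau> n < s" by (auto simp: eventually_sequentially)
    then have "(1 / 2) ^ n \<le> \<Phi> s" using s by (intro \<tau>(3)) auto
    then show ?thesis by (rule less_le_trans[rotated]) simp
  qed
  let ?mass = "\<lambda>u. \<forall>r\<ge>r0. enn2ereal (\<integral>\<^sup>+ \<theta>\<in>{-pi..pi}.
        e2ennreal (max (- u (rcis r \<theta>)) 0) * ennreal (\<Phi> \<bar>sin \<theta>\<bar>) \<partial>lborel) \<le> ereal (V r)"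
  show ?thesis
  proof (cases "0 \<le> V r0")
    case False
    (* V is negative at r0, so no function satisfies the integral condition there *)
    have no_mass: "\<not> ?mass u" for u :: "complex \<Rightarrow> ereal"
    proof
      assume "?mass u"
      then have "0 \<le> ereal (V r0)" by (meson enn2ereal_nonneg order_refl order_trans)
      then show False using False by simp
    qed
    show ?thesis
      by (intro exI[of _ "1::real"] conjI allI impI) (erule notE[OF no_mass] | simp)+
  next
    case V0: True
    have V_pos: "0 < V r" if "r0 < r" for r
    proof -
      have "0 \<le> r0 powr (- p) * V r0" using V0 by simp
      also have "\<dots> < r powr (- p) * V r" using that \<open>0 < r0\<close> by (intro inc')
      finally show ?thesis by (simp add: zero_less_mult_iff)
    qed
    have V_nonneg: "0 \<le> V r" if "r0 \<le> r" for r
      using V0 V_pos[of r] that by (cases "r = r0") auto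
    have V_growth: "V s \<le> (s / t) powr p * V t" if "r0 \<le> s" "s \<le> t" for s t
    proof (cases "s = t")
      case True
      then show ?thesis using that \<open>0 < r0\<close> by simp
    next
      case False
      then have "s powr (- p) * V s < t powr (- p) * V t" using that \<open>0 < r0\<close> by (intro inc') auto
      then have "s powr p * (s powr (- p) * V s) \<le> s powr p * (t powr (- p) * V t)"
        by (intro mult_left_mono) auto
      moreover have "s powr p * (s powr (- p) * V s) = V s"
        using that \<open>0 < r0\<close> by (simp add: powr_minus field_simps)
      moreover have "s powr p * (t powr (- p) * V t) = (s / t) powr p * V t"
        using that \<open>0 < r0\<close> by (simp add: powr_minus powr_divide field_simps)
      ultimately show ?thesis by simp
    qed
    have V_mono: "V s \<le> V t" if "r0 \<le> s" "s \<le> t" for s t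
    proof -
      have "(s / t) powr p \<le> 1 powr p" using that \<open>0 < r0\<close> p by (intro powr_mono2) auto
      then have "(s / t) powr p * V t \<le> 1 * V t" using V_nonneg[of t] that by (intro mult_right_mono) auto
      then show ?thesis using V_growth[OF that] by simp
    qed
    have "\<exists>C>0. \<forall>u. eharmonic_on u (UNIV - \<real>) \<longrightarrow> ?mass u \<longrightarrow>
        (\<exists>R0>0. \<forall>z. R0 \<le> cmod z \<longrightarrow> Im z \<noteq> 0 \<longrightarrow> (\<exists>x. u z = ereal x \<and>
           x * ((\<bar>Im z\<bar> / cmod z) ^ 3 * \<Phi> (\<bar>Im z\<bar> / cmod z / 8)) \<le> C * V (exp 4 * cmod z)))"
      by (rule off_axis_bound[where p = p]) (fact \<Phi> assms(2) p assms(3) V_nonneg V_pos V_growth)+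
    then obtain C where "0 < C" and off: "\<forall>u. eharmonic_on u (UNIV - \<real>) \<longrightarrow> ?mass u \<longrightarrow>
        (\<exists>R0>0. \<forall>z. R0 \<le> cmod z \<longrightarrow> Im z \<noteq> 0 \<longrightarrow> (\<exists>x. u z = ereal x \<and>
           x * ((\<bar>Im z\<bar> / cmod z) ^ 3 * \<Phi> (\<bar>Im z\<bar> / cmod z / 8)) \<le> C * V (exp 4 * cmod z)))"
      by (elim exE conjE)
    define c where "c = root 3 (1 / 2 :: real)"
    have c: "0 < c" "c ^ 3 = 1 / 2" by (simp_all add: c_def)
    have "c < 1"
    proof (rule ccontr)
      assume "\<not> c < 1"
      then have "1 \<le> c ^ 3" by (intro one_le_power) simp
      then show False using c by simp
    qed
    define \<omega> where "\<omega> = (\<lambda>n. 8 * \<tau> n + c ^ n)"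
    have \<omega>: "summable \<omega>" "\<And>n. 0 < \<omega> n"
      using \<tau>(1,2) c \<open>c < 1\<close> by (auto simp: \<omega>_def intro!: summable_add summable_mult summable_geometric add_pos_pos)
    have weight: "(1 / 4) ^ n \<le> t ^ 3 * \<Phi> (t / 8)" if t: "\<omega> n \<le> t" "t \<le> 1" for n t
    proof -
      have "0 < \<tau> n" "0 < c ^ n" using \<tau> c by auto
      then have "\<tau> n \<le> t / 8" "c ^ n \<le> t" using t by (auto simp: \<omega>_def)
      then have "(1 / 2) ^ n \<le> \<Phi> (t / 8)" using t by (intro \<tau>(3)) auto
      moreover have "(1 / 2) ^ n \<le> t ^ 3"
      proof -
        have "(c ^ n) ^ 3 \<le> t ^ 3" using \<open>c ^ n \<le> t\<close> \<open>0 < c ^ n\<close> by (intro power_mono) auto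
        moreover have "(c ^ n) ^ 3 = (1 / 2) ^ n" by (metis c(2) power_mult mult.commute)
        ultimately show ?thesis by simp
      qed
      ultimately have "(1 / 2) ^ n * (1 / 2) ^ n \<le> t ^ 3 * \<Phi> (t / 8)"
        using \<open>0 < c ^ n\<close> \<open>c ^ n \<le> t\<close> by (intro mult_mono) auto
      then show ?thesis by (simp add: power_mult_distrib[symmetric])
    qed
    (* 4096 steps of half-width 2 r \<omega> n have to fit into the radius r / 2 *)
    obtain N where N: "(\<Sum>n. \<omega> (n + N)) \<le> 1 / 16384"
    proof -
      obtain N where "\<And>n. N \<le> n \<Longrightarrow> norm (\<Sum>i. \<omega> (i + n)) < 1 / 16384"
        using suminf_exist_split[OF _ \<omega>(1), of "1 / 16384"] by auto
      from this[of N] show ?thesis by (intro that[of N]) simp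
    qed
    have bound: "\<exists>r1>0. \<forall>r\<ge>r1. \<forall>\<theta>\<in>{-pi..pi}. u (rcis r \<theta>) \<le> ereal (C * 4 ^ (N + 1) * V (2 * exp 4 * r))"
      if sub: "subharmonic_on u UNIV" and har: "eharmonic_on u (UNIV - \<real>)" and mass: "?mass u" for u
    proof -
      obtain R0 where "0 < R0" and R0: "\<And>z. R0 \<le> cmod z \<Longrightarrow> Im z \<noteq> 0 \<Longrightarrow> (\<exists>x. u z = ereal x \<and>
           x * ((\<bar>Im z\<bar> / cmod z) ^ 3 * \<Phi> (\<bar>Im z\<bar> / cmod z / 8)) \<le> C * V (exp 4 * cmod z))"
        using mp[OF mp[OF spec[OF off] har] mass] by (elim exE conjE) simp
      define r1 where "r1 = 2 * max R0 r0"
      have "0 < r1" using \<open>0 < R0\<close> by (simp add: r1_def)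
      have "u (rcis r \<theta>) \<le> ereal (C * 4 ^ (N + 1) * V (2 * exp 4 * r))" if r: "r1 \<le> r" for r \<theta>
      proof -
      have rpos: "0 < r" "R0 \<le> r / 2" "r0 \<le> r / 2" using r \<open>0 < R0\<close> \<open>0 < r0\<close> by (auto simp: r1_def)
      define B where "B = C * V (2 * exp 4 * r)"
      have e4: "1 \<le> exp (4::real)" by simp
      have big: "r0 < 2 * exp 4 * r"
      proof -
        have "r0 < 1 * r" using rpos \<open>0 < r0\<close> by simp
        also have "1 * r \<le> 2 * exp 4 * r"
        proof (rule mult_right_mono)
          show "1 \<le> 2 * exp (4::real)" using e4 by linarith
        qed (use rpos in simp)
        finally show ?thesis .
      qed
      have B: "0 < B" using \<open>0 < C\<close> V_pos[OF big] by (simp add: B_def)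
      have "u (rcis r \<theta>) \<le> ereal (B * 4 ^ (N + 1))"
      proof (rule domar_bound[where w = "\<lambda>n. 2 * r * \<omega> n" and R = "r / 2"])
        show "open {z. u z < a}" for a
          using sub by (simp add: subharmonic_on_def)
        show "u z < \<infinity>" for z using sub by (simp add: subharmonic_on_def)
        show "u z \<le> circle_mean u z \<rho>" if "0 < \<rho>" for z \<rho>
          using sub that by (simp add: subharmonic_on_def)
        show "summable (\<lambda>n. 2 * r * \<omega> n)" by (intro summable_mult \<omega>)
        show "0 < 2 * r * \<omega> n" for n using \<omega>(2) rpos by simp
        show "0 < B" by fact
        show "4096 * (\<Sum>n. 2 * r * \<omega> (n + N)) \<le> r / 2"
        proof -
          have "(\<Sum>n. 2 * r * \<omega> (n + N)) = 2 * r * (\<Sum>n. \<omega> (n + N))"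
            using \<omega>(1) by (intro suminf_mult) (simp add: summable_iff_shift)
          then show ?thesis using mult_left_mono[OF N, of "8192 * r"] rpos by simp
        qed
        fix n z' assume near: "dist (rcis r \<theta>) z' \<le> r / 2" and im: "2 * r * \<omega> n < \<bar>Im z'\<bar>"
        have "cmod (rcis r \<theta>) = r" using rpos by simp
        then have z': "r / 2 \<le> cmod z'" "cmod z' \<le> 2 * r"
          using near norm_triangle_ineq2[of "rcis r \<theta>" z'] norm_triangle_ineq2[of z' "rcis r \<theta>"]  rpos
          by (auto simp: dist_norm norm_minus_commute)
        have zpos: "0 < cmod z'" using z' rpos by linarith
        have "0 < 2 * r * \<omega> n" using \<omega>(2) rpos by simp
        then have im0: "Im z' \<noteq> 0" using im by auto
        obtain x where x: "u z' = ereal x"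
          "x * ((\<bar>Im z'\<bar> / cmod z') ^ 3 * \<Phi> (\<bar>Im z'\<bar> / cmod z' / 8)) \<le> C * V (exp 4 * cmod z')"
          using R0[of z'] z' rpos im0 by force
        have "C * V (exp 4 * cmod z') \<le> B"
        proof -
          have "r0 \<le> cmod z'" using z' rpos by simp
          also have "\<dots> \<le> exp 4 * cmod z'" using e4 zpos by simp
          finally have "V (exp 4 * cmod z') \<le> V (2 * exp 4 * r)" using z' by (intro V_mono) auto
          then show ?thesis using \<open>0 < C\<close> by (simp add: B_def)
        qed
        moreover have w: "(1 / 4) ^ n \<le> (\<bar>Im z'\<bar> / cmod z') ^ 3 * \<Phi> (\<bar>Im z'\<bar> / cmod z' / 8)"
        proof (rule weight)
          have "\<omega> n * cmod z' \<le> \<omega> n * (2 * r)" using z' \<omega>(2)[of n] by (intro mult_left_mono) auto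
          then show "\<omega> n \<le> \<bar>Im z'\<bar> / cmod z'" using im zpos by (simp add: le_divide_eq mult_ac)
          show "\<bar>Im z'\<bar> / cmod z' \<le> 1" using abs_Im_le_cmod[of z'] zpos by simp
        qed
        ultimately have "x \<le> B * 4 ^ n"
        proof (cases "0 \<le> x")
          case True
          have "x * (1 / 4) ^ n \<le> B"
            using mult_left_mono[OF w True] x(2) \<open>C * V (exp 4 * cmod z') \<le> B\<close> by linarith
          then show ?thesis by (simp add: power_divide field_simps)
        next
          case False
          then show ?thesis using B by (smt (verit) mult_pos_pos zero_less_power)
        qed
        then show "u z' \<le> ereal (B * 4 ^ n)" using x(1) by simp
      qed
      then show ?thesis by (simp add: B_def mult_ac)
      qed
      with \<open>0 < r1\<close> show ?thesis by blast
    qed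
    have c_pos: "0 < C * 4 ^ (N + 1)" using \<open>0 < C\<close> by simp
    have A_ge: "1 \<le> 2 * exp (4::real)" using one_le_exp_iff[of "4::real"] by linarith
    show ?thesis
      by (rule exI[of _ "C * 4 ^ (N + 1)"], rule conjI[OF c_pos], rule exI[of _ "2 * exp 4"],
          rule conjI[OF A_ge], intro allI impI, rule bound)
  qed
qed

end
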